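(* Consider the cyclic manufacturing system of $N$ production processes with homogeneous production control gain $h^i=h\in(0,1)$, known transportation delays $d^1,\dots,d^N$ (positive integers), and delay compensators, described in the context. For each $i$ let $$\gamma_m^i=\frac{3+\sqrt{1+\left((1-2h)^{d^i}-1\right)^2}}{4}.$$ Suppose that for each route $j\to i$ (i.e. $i=j+1$ for $1\le j\le N-1$, and $i=1$ for $j=N$) the transportation controller $\mathcal{C}_\tau^{j\to i}$ is a memoryless map designed such that: (i) its output $u_c^{j\to i}(t)$ lies in $[-1,1]$; (ii) the cascade connection of $\mathcal{C}_\tau^{j\to i}$ and the stochastic actuator $\mathcal{T}^{j\to i}$, with input $y_c^{j\to i}(t)$ and output $u_a^{j\to i}(t)$, is a memoryless stochastic map satisfying $E[u_a^{j\to i}(t)\,y_c^{j\to i}(t)]\ge\delta^{j\to i}E[(u_a^{j\to i}(t))^2]$ (for every value of the input $y_c^{j\to i}(t)$), where the scalars $\delta^{j\to i}$ satisfy $$\mathrm{diag}\{\delta^{j\to i}\}\ \ge\ B^T\,\mathrm{diag}\{\gamma_m^1I_2,\dots,\gamma_m^NI_2\}\,B .$$ Let $\bar x^i_{\mathrm{eq}}=\big(\tfrac1{2N}\mathbf{1}_{2N}^Tx(0)\big)\mathbf{1}_2$, $\tilde x^i(t)=x^i(t)-\bar x^i_{\mathrm{eq}}$, let $$\bar{\tilde x}^i(t)=\big[\tilde x^{iT}(t)\ \ u^{iT}(t-d^i)\ \ u^{iT}(t-d^i+1)\ \cdots\ u^{iT}(t-1)\big]^T\in\mathbb{R}^{2(d^i+1)},$$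 and $\bar{\tilde x}(t)=[\bar{\tilde x}^{1T}(t),\dots,\bar{\tilde x}^{NT}(t)]^T$. Then for every $t$ $$E\big[V(\bar{\tilde x}(t+1))\,\big|\,\bar{\tilde x}(t)\big]-V(\bar{\tilde x}(t))\le0,\qquad V(\bar{\tilde x})=\sum_{i=1}^N0.5\,\bar{\tilde x}^{iT}\,\Omega^i\,\bar{\tilde x}^i .$$
   Context: Notation: $\mathbf 1_m$ is the all-one column vector in $\mathbb{R}^m$; $I_2$ is the $2\times2$ identity; for symmetric matrices $X\ge Y$ means $X-Y$ is positive semidefinite. System. The state is $x=[x^{1T},\dots,x^{NT}]^T\in\mathbb{R}^{2N}$, $x^i=[x_I^i,\ x_O^i]^T$ (stock levels of the input and output buffers of process $i$). With $u_a(t)=[u_a^{1\to2}(t),\dots,u_a^{N\to1}(t)]^T\in\mathbb{R}^N$, the stacked vector $u(t)=[u^{1T}(t),\dots,u^{NT}(t)]^T\in\mathbb{R}^{2N}$ is $u(t)=Bu_a(t)$, where $B\in\mathbb{R}^{2N\times N}$ is the incidence matrix: the column of route $j\to i$ has entry $-1$ in the row of $x_O^j$, entry $+1$ in the row of $x_I^i$, and $0$ elsewhere. So $u^i=[u_a^{k\to i},\,-u_a^{i\to l}]^T$ for the cyclic predecessor $k$ and successor $l$ of $i$. The transport into the input buffer of process $i$ is delayed by $d^i$ steps: $$x^i(t+1)=A^ix^i(t)+B_Ou^i(t)+B_Iu^i(t-d^i),\quad A^i=\begin{bmatrix} 1-h & h \\ h & 1-h \end{bmatrix},\ B_I=\begin{bmatrix}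 1 & 0 \\ 0 & 0 \end{bmatrix},\ B_O=I_2-B_I,$$ with given initial data $x(0)$ and $u^i(s)$, $-d^i\le s<0$. Matrix $\Omega^i$. It is the symmetric block matrix $\Omega^i=\{\Omega^i_{j,k}\}_{1\le j,k\le d^i+1}$ with $2\times2$ blocks: $\Omega^i_{j,j}=I_2$ for all $j$; $\Omega^i_{1,2}=A^i\Omega^i_{1,1}B_I$; $\Omega^i_{1,j}=A^i\Omega^i_{1,j-1}$ for $3\le j\le d^i+1$; $\Omega^i_{2,j}=B_I\Omega^i_{1,j-1}$ for $3\le j\le d^i+1$; $\Omega^i_{j,k}=\Omega^i_{j-1,k-1}$ for $3\le j<k\le d^i+1$; $\Omega^i_{j,k}=(\Omega^i_{k,j})^T$ for $k<j$. Delay compensator. For each $i$, $$y^i(t)=C^i_1x^i(t)+\sum_{j=1}^{d^i}C^i_{j+1}u^i(t-d^i+j-1),$$ $C_1^i=B_O\Omega^i_{1,1}A^i+\Omega^i_{d^i+1,1}A^i$, $C_2^i=B_O\Omega^i_{1,1}B_I+\Omega^i_{d^i+1,1}B_I$, $C^i_j=B_O\Omega^i_{1,j-1}+\Omega^i_{d^i+1,j-1}B_I$ for $3\le j\le d^i+1$. Feedback. With $y(t)=[y^{1T}(t),\dots,y^{NT}(t)]^T$, the controller inputs are the components $y_c^{j\to i}(t)$ of $y_c(t)=-B^Ty(t)\in\mathbb{R}^N$ (indexed by routes as the columns of $B$); $u_c^{j\to i}(t)=\mathcal{C}_\tau^{j\to i}(y_c^{j\to i}(t))$ (a deterministic function)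 and $u_a^{j\to i}(t)=\mathcal{T}^{j\to i}(u_c^{j\to i}(t))$. The diagonal matrix $\mathrm{diag}\{\delta^{j\to i}\}$ is indexed by routes in the same order as the columns of $B$. Stochastic actuator. For $u_c\in[-1,1]$, $\mathcal{T}^{j\to i}(u_c)$ is a random variable equal to $+1$ with probability $\max(u_c,0)$, $-1$ with probability $\max(-u_c,0)$, and $0$ with probability $1-|u_c|$. Expectations in (ii) are over this randomness for given $y_c^{j\to i}(t)$; conditionally on the current states $x(t)$ and past inputs $u^i(t-d^i),\dots,u^i(t-1)$ (all $i$), each $u_a^{j\to i}(t)$ equals $+1$ with probability $\max(u_c^{j\to i}(t),0)$, $-1$ with probability $\max(-u_c^{j\to i}(t),0)$, and $0$ with probability $1-|u_c^{j\to i}(t)|$. *)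

theory Defs
  imports "HOL-Probability.Probability" "Jordan_Normal_Form.Matrix"
begin

text \<open>
  Vectors and matrices are those of \<^theory>\<open>Jordan_Normal_Form.Matrix\<close>, so that the dimensions
  (number of processes, delays) are ordinary natural numbers.
\<close>

unbundle no vec_syntax
hide_type (open) Finite_Cartesian_Product.vec
hide_const (open) Finite_Cartesian_Product.vec Finite_Cartesian_Product.mat

text \<open>
  Conventions. Processes are numbered \<open>0, \<dots>, N - 1\<close>, and route \<open>r < N\<close> is the one leaving process
  \<open>r\<close>, that is \<open>r \<rightarrow> (r + 1) mod N\<close>; this is the column order of the incidence matrix.
  In a two-dimensional vector attached to a process, component \<open>0\<close> is the input buffer and
  component \<open>1\<close> the output buffer. A vector with \<open>n\<close> blocks of length two stores
  component \<open>c\<close> of block \<open>b\<close> at position \<open>2 * b + c\<close>, with \<open>b\<close> counted from \<open>0\<close>. The block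
  indices of \<open>Omega\<close> and the indices of \<open>comp_gain\<close> start at \<open>1\<close>.
\<close>

definition A_mat :: "real \<Rightarrow> real mat" where
  "A_mat h = mat_of_rows_list 2 [[1 - h, h], [h, 1 - h]]"

definition B_I :: "real mat" where
  "B_I = mat_of_rows_list 2 [[1, 0], [0, 0]]"

definition B_O :: "real mat" where
  "B_O = 1\<^sub>m 2 - B_I"

definition ones_vec :: "nat \<Rightarrow> real vec" where
  "ones_vec n = vec n (\<lambda>_. 1)"

definition stack2 :: "nat \<Rightarrow> (nat \<Rightarrow> real vec) \<Rightarrow> real vec" where
  "stack2 n f = vec (2 * n) (\<lambda>p. f (p div 2) $ (p mod 2))"

definition block2 :: "nat \<Rightarrow> real vec \<Rightarrow> real vec" where
  "block2 b v = vec 2 (\<lambda>c. v $ (2 * b + c))"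

definition incidence :: "nat \<Rightarrow> real mat" where
  "incidence N = mat (2 * N) N (\<lambda>(p, r).
     if p = 2 * r + 1 then - 1 else if p = 2 * ((r + 1) mod N) then 1 else 0)"

text \<open>
  The blocks do not depend on the delay, which only determines the size of the block matrix.
  Block indices \<open>0\<close> are never used.
\<close>

function Omega :: "real \<Rightarrow> nat \<Rightarrow> nat \<Rightarrow> real mat" where
  "Omega h j k =
     (if j = k then 1\<^sub>m 2
      else if k < j then (Omega h k j)\<^sup>T
      else if j = 1 \<and> k = 2 then A_mat h * Omega h 1 1 * B_I
      else if j = 1 then A_mat h * Omega h 1 (k - 1)
      else if j = 2 then B_I * Omega h 1 (k - 1)
      else Omega h (j - 1) (k - 1))"
  by pat_completeness auto
termination
  by (relation "Wellfounded.measure (\<lambda>(h, j, k). 2 * (j + k) + (if k < j then 1 else 0))") auto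

declare Omega.simps [simp del]

definition Omega_mat :: "real \<Rightarrow> nat \<Rightarrow> real mat" where
  "Omega_mat h d = mat (2 * (d + 1)) (2 * (d + 1))
     (\<lambda>(p, q). Omega h (p div 2 + 1) (q div 2 + 1) $$ (p mod 2, q mod 2))"

definition comp_gain :: "real \<Rightarrow> nat \<Rightarrow> nat \<Rightarrow> real mat" where
  "comp_gain h d j =
     (if j = 1 then B_O * Omega h 1 1 * A_mat h + Omega h (d + 1) 1 * A_mat h
      else if j = 2 then B_O * Omega h 1 1 * B_I + Omega h (d + 1) 1 * B_I
      else B_O * Omega h 1 (j - 1) + Omega h (d + 1) (j - 1) * B_I)"

text \<open>The sum of vectors is written componentwise.\<close>

definition comp_out :: "real \<Rightarrow> nat \<Rightarrow> real vec \<Rightarrow> (int \<Rightarrow> real vec) \<Rightarrow> int \<Rightarrow> real vec" where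
  "comp_out h d x u t = vec 2 (\<lambda>c. (comp_gain h d 1 *\<^sub>v x) $ c
     + (\<Sum>j = 1..d. (comp_gain h d (j + 1) *\<^sub>v u (t - int d + int j - 1)) $ c))"

text \<open>The vector with the blocks \<open>x\<close>, \<open>u (t - d)\<close>, \<open>u (t - d + 1)\<close>, ... \<open>u (t - 1)\<close>.\<close>

definition ext_state :: "nat \<Rightarrow> real vec \<Rightarrow> (int \<Rightarrow> real vec) \<Rightarrow> int \<Rightarrow> real vec" where
  "ext_state d x u t =
     stack2 (d + 1) (\<lambda>b. if b = 0 then x else u (t - int d + int b - 1))"

definition x_eq :: "nat \<Rightarrow> (nat \<Rightarrow> real vec) \<Rightarrow> real vec" where
  "x_eq N x0 = (1 / (2 * real N) * (ones_vec (2 * N) \<bullet> stack2 N x0)) \<cdot>\<^sub>v ones_vec 2"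

definition lyapunov :: "real \<Rightarrow> nat \<Rightarrow> (nat \<Rightarrow> nat) \<Rightarrow> (nat \<Rightarrow> real vec) \<Rightarrow> real" where
  "lyapunov h N d \<xi> = (\<Sum>i<N. 1 / 2 * (\<xi> i \<bullet> (Omega_mat h (d i) *\<^sub>v \<xi> i)))"

definition gamma_m :: "real \<Rightarrow> nat \<Rightarrow> real" where
  "gamma_m h d = (3 + sqrt (1 + ((1 - 2 * h) ^ d - 1)\<^sup>2)) / 4"

definition psd_mat :: "real mat \<Rightarrow> bool" where
  "psd_mat X \<longleftrightarrow> square_mat X \<and> X\<^sup>T = X \<and> (\<forall>v \<in> carrier_vec (dim_row X). 0 \<le> v \<bullet> (X *\<^sub>v v))"

definition actuator :: "real \<Rightarrow> real pmf" where
  "actuator v = map_pmf (\<lambda>b. if b then sgn v else 0) (bernoulli_pmf \<bar>v\<bar>)"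

lemma pmf_actuator:
  assumes "v \<in> {-1..1}"
  shows "pmf (actuator v) 1 = max v 0"
    and "pmf (actuator v) (-1) = max (- v) 0"
    and "pmf (actuator v) 0 = 1 - \<bar>v\<bar>"
proof -
  have *: "pmf (actuator v) a = (if sgn v = a then \<bar>v\<bar> else 0) + (if 0 = a then 1 - \<bar>v\<bar> else 0)" for a
  proof -
    have "pmf (actuator v) a =
        sum (pmf (bernoulli_pmf \<bar>v\<bar>)) {b \<in> UNIV. (if b then sgn v else 0) = a}"
      unfolding actuator_def pmf_map by (simp add: measure_measure_pmf_finite vimage_def)
    also have "\<dots> = (\<Sum>b\<in>UNIV. if (if b then sgn v else 0) = a then pmf (bernoulli_pmf \<bar>v\<bar>) b else 0)"
      by (rule sum.inter_filter) simp
    finally show ?thesis using assms by (simp add: UNIV_bool abs_le_iff)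
  qed
  show "pmf (actuator v) 1 = max v 0" "pmf (actuator v) (-1) = max (- v) 0"
    "pmf (actuator v) 0 = 1 - \<bar>v\<bar>"
    unfolding * using assms by (auto simp: sgn_if max_def)
qed

text \<open>
  The sub-sigma-algebra generated by the random vectors \<open>\<xi> i\<close>, \<open>i < N\<close>, of dimensions
  \<open>2 * (d i + 1)\<close>, i.e. by all their components.
\<close>

definition state_algebra ::
    "'w measure \<Rightarrow> nat \<Rightarrow> (nat \<Rightarrow> nat) \<Rightarrow> (nat \<Rightarrow> 'w \<Rightarrow> real vec) \<Rightarrow> 'w measure" where
  "state_algebra M N d \<xi> = sigma (space M)
     {(\<lambda>\<omega>. \<xi> i \<omega> $ p) -` S \<inter> space M | i p S. i < N \<and> p < 2 * (d i + 1) \<and> S \<in> sets borel}"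

end

theory Submission
  imports Defs
begin

text \<open>
  With \<open>A_mat h ^ k = [[a k, b k], [b k, a k]]\<close> all blocks of \<open>\<Omega>\<close> are explicit, and the storage
  function of a process is a quadratic form whose part in the delayed inputs has the kernel
  \<open>a \<bar>j - k\<bar>\<close>, i.e. is invariant under shifting the delay line. One step of the free dynamics therefore does not
  increase it, the term linear in the new input \<open>u\<close> is \<open>u \<bullet> y\<close>, and the term quadratic in \<open>u\<close> is at most
  \<open>\<gamma>\<^sub>m \<parallel>u\<parallel>\<^sup>2\<close>. Summing over the processes and using \<open>u = B u\<^sub>a\<close>, \<open>y\<^sub>c = - B\<^sup>T y\<close>
  and the bound on \<open>\<delta>\<close>, the increment of \<open>V\<close> is at most \<open>\<Sum>r. \<delta> r * (u\<^sub>a r)\<^sup>2 - u\<^sub>a r * y\<^sub>c r\<close>;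
  the equilibrium drops out since \<open>B\<^sup>T\<close> annihilates the all-one vector. Conditionally on the state,
  \<open>E[u\<^sub>a r] = u\<^sub>c r\<close> and \<open>E[(u\<^sub>a r)\<^sup>2] = \<bar>u\<^sub>c r\<bar>\<close>, so this bound has nonpositive conditional
  expectation by passivity. The initial data are deterministic, hence everything is essentially
  bounded, and so integrable, at each time.
\<close>

subsection \<open>Dissipation of a single process\<close>

text \<open>The entries of \<open>A_mat h ^ k\<close>.\<close>

definition diag_pow :: "real \<Rightarrow> nat \<Rightarrow> real" where
  "diag_pow h k = (1 + (1 - 2 * h) ^ k) / 2"

definition offdiag_pow :: "real \<Rightarrow> nat \<Rightarrow> real" where
  "offdiag_pow h k = (1 - (1 - 2 * h) ^ k) / 2"

lemma diag_pow_0 [simp]: "diag_pow h 0 = 1"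
  and offdiag_pow_0 [simp]: "offdiag_pow h 0 = 0"
  by (simp_all add: diag_pow_def offdiag_pow_def)

lemma diag_pow_Suc: "diag_pow h (Suc k) = (1 - h) * diag_pow h k + h * offdiag_pow h k"
  and offdiag_pow_Suc: "offdiag_pow h (Suc k) = h * diag_pow h k + (1 - h) * offdiag_pow h k"
  by (simp_all add: diag_pow_def offdiag_pow_def field_simps)

text \<open>The Toeplitz kernel formed by \<open>diag_pow h\<close> of the distance between two
  delayed inputs; the case split computes that distance without truncated subtraction.\<close>

definition dist_kernel :: "real \<Rightarrow> nat \<Rightarrow> nat \<Rightarrow> real" where
  "dist_kernel h b c = diag_pow h (if b \<le> c then c - b else b - c)"

lemma dist_kernel_self [simp]: "dist_kernel h b b = 1"
  and dist_kernel_Suc_Suc [simp]: "dist_kernel h (Suc b) (Suc c) = dist_kernel h b c"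
  by (auto simp: dist_kernel_def)

section \<open>Arithmetic of two-by-two matrices and of sums over blocks of length two\<close>

lemma less_2_iff: "c < 2 \<longleftrightarrow> c = 0 \<or> c = (1::nat)"
  by auto

lemma sum_double:
  fixes f :: "nat \<Rightarrow> 'a::comm_monoid_add"
  shows "sum f {..<2 * n} = (\<Sum>b<n. f (2 * b) + f (2 * b + 1))"
  by (induction n) (simp_all add: algebra_simps)

lemma A_mat_carrier [simp]: "A_mat h \<in> carrier_mat 2 2"
  and B_I_carrier [simp]: "B_I \<in> carrier_mat 2 2"
  and B_O_carrier [simp]: "B_O \<in> carrier_mat 2 2"
  by (auto simp: A_mat_def B_I_def B_O_def mat_of_rows_list_def)

lemma transport_mat_dims [simp]:
  "dim_row (A_mat h) = 2" "dim_col (A_mat h) = 2" "dim_row B_I = 2" "dim_col B_I = 2"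
  "dim_row B_O = 2" "dim_col B_O = 2"
  by (auto simp: A_mat_def B_I_def B_O_def mat_of_rows_list_def)

text \<open>Fully expanded entries of a product. Later proofs delete
  \<open>index_mult_mat(1)\<close> from the simpset so that this form is reached instead of a scalar
  product.\<close>

lemma mult_mat_2:
  assumes "M \<in> carrier_mat 2 2" "L \<in> carrier_mat 2 2" "i < 2" "j < 2"
  shows "(M * L) $$ (i, j) = M $$ (i, 0) * L $$ (0, j) + M $$ (i, 1) * (L $$ (1, j) :: real)"
  using assms by (auto simp: scalar_prod_def numeral_2_eq_2)

lemma mult_mat_vec_2:
  assumes "M \<in> carrier_mat 2 2" "v \<in> carrier_vec 2" "i < 2"
  shows "(M *\<^sub>v v) $ i = M $$ (i, 0) * v $ 0 + M $$ (i, 1) * (v $ 1 :: real)"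
  using assms by (auto simp: scalar_prod_def numeral_2_eq_2)

lemma A_mat_index [simp]:
  "A_mat h $$ (0, 0) = 1 - h" "A_mat h $$ (0, Suc 0) = h"
  "A_mat h $$ (Suc 0, 0) = h" "A_mat h $$ (Suc 0, Suc 0) = 1 - h"
  by (simp_all add: A_mat_def mat_of_rows_list_def)

lemma B_I_index [simp]:
  "B_I $$ (0, 0) = 1" "B_I $$ (0, Suc 0) = 0" "B_I $$ (Suc 0, 0) = 0" "B_I $$ (Suc 0, Suc 0) = 0"
  by (simp_all add: B_I_def mat_of_rows_list_def)

lemma B_O_index [simp]:
  "B_O $$ (0, 0) = 0" "B_O $$ (0, Suc 0) = 0" "B_O $$ (Suc 0, 0) = 0" "B_O $$ (Suc 0, Suc 0) = 1"
  by (simp_all add: B_O_def B_I_def mat_of_rows_list_def)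

section \<open>Closed form of the blocks of \<open>Omega\<close>\<close>

lemma Omega_diag: "Omega h j j = 1\<^sub>m 2"
  by (subst Omega.simps) simp

lemma Omega_carrier [simp]: "Omega h j k \<in> carrier_mat 2 2"
proof (induction h j k rule: Omega.induct)
  case (1 h j k)
  then show ?case
    by (subst Omega.simps)
       (auto simp: transpose_carrier_mat intro!: mult_carrier_mat[where n = 2])
qed

lemma Omega_dims [simp]: "dim_row (Omega h j k) = 2" "dim_col (Omega h j k) = 2"
  using Omega_carrier by (blast dest: carrier_matD)+

lemma Omega_transpose: "k < j \<Longrightarrow> Omega h j k = (Omega h k j)\<^sup>T"
  by (subst Omega.simps) simp

text \<open>The recursion starts from \<open>A * B_I\<close> and multiplies by \<open>A\<close> on
  the left, so block \<open>(1, k + 2)\<close> is \<open>A^(k+1) * B_I\<close>: the first column of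
  the power followed by a zero column.\<close>

lemma Omega_first_row:
  "Omega h 1 (Suc (Suc k)) $$ (0, 0) = diag_pow h (Suc k) \<and>
   Omega h 1 (Suc (Suc k)) $$ (1, 0) = offdiag_pow h (Suc k) \<and>
   Omega h 1 (Suc (Suc k)) $$ (0, 1) = 0 \<and> Omega h 1 (Suc (Suc k)) $$ (1, 1) = 0"
proof (induction k)
  case 0
  have "Omega h 1 2 = A_mat h * 1\<^sub>m 2 * B_I"
    by (subst Omega.simps) (simp add: Omega_diag)
  then have "Omega h 1 2 = A_mat h * B_I"
    by (simp add: right_mult_one_mat[OF A_mat_carrier])
  then show ?case
    by (simp add: mult_mat_2 numeral_2_eq_2[symmetric] diag_pow_Suc offdiag_pow_Suc
      del: index_mult_mat(1))
next
  case (Suc k)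
  have "Omega h 1 (Suc (Suc (Suc k))) = A_mat h * Omega h 1 (Suc (Suc k))"
    by (subst Omega.simps) simp
  with Suc show ?case
    by (simp add: mult_mat_2 diag_pow_Suc[of h "Suc k"] offdiag_pow_Suc[of h "Suc k"]
      del: index_mult_mat(1))
qed

text \<open>Block \<open>j + 2\<close> belongs to delayed input \<open>j\<close>, counted from 0.
  The row of input 0 is \<open>B_I * A^k * B_I\<close>, which keeps only the entry
  \<open>diag_pow h k\<close>; further rows repeat it along the diagonals, whence
  \<open>k - j\<close>.\<close>

lemma Omega_input_blocks_less:
  "j < k \<Longrightarrow> p < 2 \<Longrightarrow> q < 2 \<Longrightarrow>
   Omega h (Suc (Suc j)) (Suc (Suc k)) $$ (p, q) = (if p = 0 \<and> q = 0 then diag_pow h (k - j) else 0)"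
proof (induction j arbitrary: k)
  case 0
  then obtain m where k: "k = Suc m" by (cases k) auto
  have "Omega h 2 (Suc (Suc k)) = B_I * Omega h 1 (Suc (Suc m))"
    by (subst Omega.simps) (simp add: k)
  with 0 k Omega_first_row[of h m] show ?case
    by (auto simp: mult_mat_2 numeral_2_eq_2[symmetric] less_2_iff
      simp del: index_mult_mat(1))
next
  case (Suc j)
  then obtain m where k: "k = Suc m" by (cases k) auto
  have "Omega h (Suc (Suc (Suc j))) (Suc (Suc k)) = Omega h (Suc (Suc j)) (Suc (Suc m))"
    using Suc.prems by (subst Omega.simps) (simp add: k)
  with Suc k show ?case by simp
qed

text \<open>A diagonal block is the identity: \<open>dist_kernel h j j = 1\<close> accounts for one
  of its ones, the second case for the other.\<close>

lemma Omega_input_blocks: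
  assumes "p < 2" "q < 2"
  shows "Omega h (Suc (Suc j)) (Suc (Suc k)) $$ (p, q) =
    (if p = 0 \<and> q = 0 then dist_kernel h j k else if j = k \<and> p = q then 1 else 0)"
proof (cases j k rule: linorder_cases)
  case equal
  with assms show ?thesis by (auto simp: Omega_diag less_2_iff)
next
  case less
  with assms show ?thesis by (auto simp: Omega_input_blocks_less dist_kernel_def)
next
  case greater
  have "Omega h (Suc (Suc j)) (Suc (Suc k)) $$ (p, q) = Omega h (Suc (Suc k)) (Suc (Suc j)) $$ (q, p)"
    using greater assms by (simp add: Omega_transpose)
  with greater assms show ?thesis by (auto simp: Omega_input_blocks_less dist_kernel_def)
qed

lemma Omega_first_column:
  assumes "p < 2" "q < 2"
  shows "Omega h (Suc (Suc k)) 1 $$ (p, q) = Omega h 1 (Suc (Suc k)) $$ (q, p)"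
  using assms by (simp add: Omega_transpose[of "Suc 0"])

text \<open>
  Twice the storage function of a process, written with the components \<open>x0\<close>, \<open>x1\<close> of the state and
  the components \<open>p b\<close>, \<open>q b\<close> of \<open>u (t - d + b)\<close>; index \<open>d\<close> is thus the current input.
\<close>

definition storage :: "real \<Rightarrow> nat \<Rightarrow> real \<Rightarrow> real \<Rightarrow> (nat \<Rightarrow> real) \<Rightarrow> (nat \<Rightarrow> real) \<Rightarrow> real" where
  "storage h d x0 x1 p q = x0\<^sup>2 + x1\<^sup>2
     + 2 * (\<Sum>b<d. (diag_pow h (Suc b) * x0 + offdiag_pow h (Suc b) * x1) * p b)
     + (\<Sum>b<d. (q b)\<^sup>2) + (\<Sum>b<d. \<Sum>c<d. dist_kernel h b c * p b * p c)"

section \<open>The quadratic form of \<open>Omega_mat\<close> as a storage function\<close>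

lemma quadratic_form_sum:
  assumes "X \<in> carrier_mat n n" "v \<in> carrier_vec n"
  shows "v \<bullet> (X *\<^sub>v v) = (\<Sum>p<n. \<Sum>q<n. v $ p * X $$ (p, q) * (v $ q :: real))"
  using assms
  by (auto simp: scalar_prod_def sum_distrib_left mult.assoc atLeast0LessThan intro!: sum.cong)

lemma Omega_mat_quadratic_form_sum:
  assumes "v \<in> carrier_vec (2 * (d + 1))"
  shows "v \<bullet> (Omega_mat h d *\<^sub>v v) = (\<Sum>p<2 * (d + 1). \<Sum>q<2 * (d + 1).
     v $ p * Omega h (p div 2 + 1) (q div 2 + 1) $$ (p mod 2, q mod 2) * v $ q)"
  by (subst quadratic_form_sum[OF _ assms]) (auto simp: Omega_mat_def intro!: sum.cong)

text \<open>Split by pairs of blocks: the state with itself, two cross sums that agree by symmetry,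
  and the inputs with each other. Output-buffer components of the inputs survive only in the
  diagonal blocks, as squares.\<close>

lemma Omega_mat_quadratic_form:
  assumes "v \<in> carrier_vec (2 * (d + 1))"
  shows "v \<bullet> (Omega_mat h d *\<^sub>v v) =
    storage h d (v $ 0) (v $ 1) (\<lambda>b. v $ (2 * Suc b)) (\<lambda>b. v $ (2 * Suc b + 1))"
proof -
  \<comment> \<open>\<open>F b c\<close> collects the four products of blocks \<open>b\<close> and
    \<open>c\<close>, which are counted from 0 in \<open>v\<close> but from 1 in
    \<open>Omega\<close>.\<close>
  define F where "F b c = (\<Sum>p<2. \<Sum>q<2. v $ (2 * b + p) * Omega h (Suc b) (Suc c) $$ (p, q) * v $ (2 * c + q))"
    for b c
  have two: "sum f {..<2::nat} = f 0 + f 1" for f :: "nat \<Rightarrow> real"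
    by (simp add: numeral_2_eq_2)
  have idx: "(2 * b) div 2 = b" "(2 * b + 1) div 2 = b" "(2 * b) mod 2 = 0" "(2 * b + 1) mod 2 = 1" for b :: nat
    by simp_all
  have "v \<bullet> (Omega_mat h d *\<^sub>v v) = (\<Sum>b<d + 1. \<Sum>c<d + 1. F b c)"
    unfolding Omega_mat_quadratic_form_sum[OF assms] sum_double idx F_def two
    by (simp add: sum.distrib algebra_simps)
  also have "\<dots> = F 0 0 + (\<Sum>c<d. F 0 (Suc c)) + (\<Sum>b<d. F (Suc b) 0) + (\<Sum>b<d. \<Sum>c<d. F (Suc b) (Suc c))"
    by (simp add: sum.lessThan_Suc_shift sum.distrib del: sum.lessThan_Suc)
  also have "F 0 0 = (v $ 0)\<^sup>2 + (v $ 1)\<^sup>2"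
    by (simp add: F_def two Omega_diag power2_eq_square)
  also have "(\<Sum>c<d. F 0 (Suc c)) =
      (\<Sum>b<d. (diag_pow h (Suc b) * v $ 0 + offdiag_pow h (Suc b) * v $ 1) * v $ (2 * Suc b))"
    using Omega_first_row[of h] by (intro sum.cong) (simp_all add: F_def two algebra_simps)
  also have "(\<Sum>b<d. F (Suc b) 0) =
      (\<Sum>b<d. (diag_pow h (Suc b) * v $ 0 + offdiag_pow h (Suc b) * v $ 1) * v $ (2 * Suc b))"
    using Omega_first_row[of h] Omega_first_column[of _ _ h]
    by (intro sum.cong) (simp_all add: F_def two algebra_simps)
  also have "(\<Sum>b<d. \<Sum>c<d. F (Suc b) (Suc c)) =
      (\<Sum>b<d. \<Sum>c<d. dist_kernel h b c * v $ (2 * Suc b) * v $ (2 * Suc c)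
         + (if b = c then (v $ (2 * Suc b + 1))\<^sup>2 else 0))"
    by (intro sum.cong) (simp_all add: F_def two Omega_input_blocks power2_eq_square)
  also have "\<dots> = (\<Sum>b<d. \<Sum>c<d. dist_kernel h b c * v $ (2 * Suc b) * v $ (2 * Suc c))
      + (\<Sum>b<d. (v $ (2 * Suc b + 1))\<^sup>2)"
    by (simp add: sum.distrib)
  finally show ?thesis by (simp add: storage_def)
qed

text \<open>The two components of the compensator output.\<close>

definition out_I :: "real \<Rightarrow> nat \<Rightarrow> real \<Rightarrow> real \<Rightarrow> (nat \<Rightarrow> real) \<Rightarrow> real" where
  "out_I h d x0 x1 p = diag_pow h (Suc d) * x0 + offdiag_pow h (Suc d) * x1
     + (\<Sum>b<d. diag_pow h (d - b) * p b)"

definition out_O :: "real \<Rightarrow> nat \<Rightarrow> real \<Rightarrow> real \<Rightarrow> (nat \<Rightarrow> real) \<Rightarrow> real" where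
  "out_O h d x0 x1 p = h * x0 + (1 - h) * x1 + (\<Sum>b<d. offdiag_pow h b * p b)"

text \<open>As \<open>A\<close> is symmetric, \<open>Omega h (d + 1) 1 * A\<close> is
  \<open>B_I * A^(d+1)\<close>; adding \<open>B_O * A\<close> puts a row of \<open>A^(d+1)\<close>
  above a row of \<open>A\<close>. The bound \<open>1 \<le> d\<close> keeps block
  \<open>(d + 1, 1)\<close> off the diagonal.\<close>

lemma comp_gain_1_index:
  assumes "1 \<le> d"
  shows "comp_gain h d 1 $$ (0, 0) = diag_pow h (Suc d)" "comp_gain h d 1 $$ (0, 1) = offdiag_pow h (Suc d)"
    "comp_gain h d 1 $$ (1, 0) = h" "comp_gain h d 1 $$ (1, 1) = 1 - h"
proof -
  obtain k where d: "d = Suc k" using assms by (cases d) auto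
  have "B_O * 1\<^sub>m 2 * A_mat h = B_O * A_mat h"
    by (simp add: right_mult_one_mat[OF B_O_carrier])
  then have "comp_gain h d 1 = B_O * A_mat h + Omega h (Suc (Suc k)) 1 * A_mat h"
    by (simp add: comp_gain_def Omega_diag[of h "Suc 0"] d)
  then show "comp_gain h d 1 $$ (0, 0) = diag_pow h (Suc d)" "comp_gain h d 1 $$ (0, 1) = offdiag_pow h (Suc d)"
    "comp_gain h d 1 $$ (1, 0) = h" "comp_gain h d 1 $$ (1, 1) = 1 - h"
    using Omega_first_column[of _ _ h k] Omega_first_row[of h k]
    by (simp_all add: mult_mat_2 diag_pow_Suc[of h "Suc k"] offdiag_pow_Suc[of h "Suc k"] d algebra_simps
        del: index_mult_mat(1))
qed

text \<open>This is the gain on \<open>u (t - d + b)\<close>. For positive \<open>b\<close> it is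
  \<open>B_O * A^b * B_I\<close> plus the kernel entry at distance \<open>d - b\<close>; for
  \<open>b = 0\<close> the separate formula gives the same pattern because
  \<open>B_O * B_I = 0\<close>.\<close>

lemma comp_gain_Suc_Suc_index:
  assumes "b < d"
  shows "comp_gain h d (Suc (Suc b)) $$ (0, 0) = diag_pow h (d - b)" "comp_gain h d (Suc (Suc b)) $$ (0, 1) = 0"
    "comp_gain h d (Suc (Suc b)) $$ (1, 0) = offdiag_pow h b" "comp_gain h d (Suc (Suc b)) $$ (1, 1) = 0"
proof -
  obtain k where d: "d = Suc k" using assms by (cases d) auto
  have "comp_gain h d (Suc (Suc b)) $$ (0, 0) = diag_pow h (d - b) \<and> comp_gain h d (Suc (Suc b)) $$ (0, 1) = 0 \<and>
    comp_gain h d (Suc (Suc b)) $$ (1, 0) = offdiag_pow h b \<and> comp_gain h d (Suc (Suc b)) $$ (1, 1) = 0"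
  proof (cases b)
    case 0
    have "B_O * 1\<^sub>m 2 * B_I = B_O * B_I"
      by (simp add: right_mult_one_mat[OF B_O_carrier])
    then have "comp_gain h d (Suc (Suc b)) = B_O * B_I + Omega h (Suc (Suc k)) 1 * B_I"
      by (simp add: comp_gain_def Omega_diag[of h "Suc 0"] d 0)
    then show ?thesis
      using Omega_first_column[of _ _ h k] Omega_first_row[of h k]
      by (simp add: mult_mat_2 0 d del: index_mult_mat(1))
  next
    case (Suc m)
    have "comp_gain h d (Suc (Suc b)) = B_O * Omega h 1 (Suc (Suc m)) + Omega h (Suc (Suc k)) (Suc (Suc m)) * B_I"
      by (simp add: comp_gain_def d Suc)
    then show ?thesis
      using Omega_first_row[of h m] Suc assms
      by (simp add: mult_mat_2 Omega_input_blocks d dist_kernel_def del: index_mult_mat(1))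
  qed
  then show "comp_gain h d (Suc (Suc b)) $$ (0, 0) = diag_pow h (d - b)" "comp_gain h d (Suc (Suc b)) $$ (0, 1) = 0"
    "comp_gain h d (Suc (Suc b)) $$ (1, 0) = offdiag_pow h b" "comp_gain h d (Suc (Suc b)) $$ (1, 1) = 0"
    by auto
qed

lemma comp_gain_carrier: "comp_gain h d j \<in> carrier_mat 2 2"
  unfolding comp_gain_def
  by (auto intro!: add_carrier_mat mult_carrier_mat[where n = 2])

lemma comp_out_index:
  assumes "1 \<le> d" "x \<in> carrier_vec 2" "\<And>b. b < d \<Longrightarrow> u (t - int d + int b) \<in> carrier_vec 2"
  shows "comp_out h d x u t $ 0 = out_I h d (x $ 0) (x $ 1) (\<lambda>b. u (t - int d + int b) $ 0)"
    and "comp_out h d x u t $ 1 = out_O h d (x $ 0) (x $ 1) (\<lambda>b. u (t - int d + int b) $ 0)"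
proof -
  have shift: "(\<Sum>j = 1..d. f j) = (\<Sum>b<d. f (Suc b))" for f :: "nat \<Rightarrow> real"
    by (simp add: sum.atLeast1_atMost_eq)
  have s: "t - int d + int (Suc b) - 1 = t - int d + int b" for b
    by simp
  show "comp_out h d x u t $ 0 = out_I h d (x $ 0) (x $ 1) (\<lambda>b. u (t - int d + int b) $ 0)"
    using assms comp_gain_1_index[OF assms(1)] unfolding comp_out_def shift s out_I_def
    by (auto simp: mult_mat_vec_2[OF comp_gain_carrier] comp_gain_Suc_Suc_index[simplified]
        simp del: index_mult_mat_vec intro!: sum.cong)
  show "comp_out h d x u t $ 1 = out_O h d (x $ 0) (x $ 1) (\<lambda>b. u (t - int d + int b) $ 0)"
    using assms comp_gain_1_index[OF assms(1)] unfolding comp_out_def shift s out_O_def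
    by (auto simp: mult_mat_vec_2[OF comp_gain_carrier] comp_gain_Suc_Suc_index[simplified]
        simp del: index_mult_mat_vec intro!: sum.cong)
qed

text \<open>The rows of every power of \<open>A\<close> sum to one, that is
  \<open>diag_pow h k + offdiag_pow h k = 1\<close>.\<close>

lemma out_translate:
  "out_I h d (x0 - e) (x1 - e) p = out_I h d x0 x1 p - e"
  "out_O h d (x0 - e) (x1 - e) p = out_O h d x0 x1 p - e"
  by (simp_all add: out_I_def out_O_def diag_pow_def offdiag_pow_def field_simps)

text \<open>An exact balance. Applying \<open>A\<close> lowers the squared norm of the state by
  \<open>2 h (1 - h) (x0 - x1)^2\<close>, \<open>p 0\<close> moves from the delay line into the
  state, and the Toeplitz part changes only by boundary terms. The square of \<open>q d\<close> has
  coefficient 2 because \<open>q d\<close> enters the output buffer and the delay line at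
  once.\<close>

lemma storage_step:
  fixes h :: real and d :: nat
  defines "X0 \<equiv> \<lambda>x0 x1 p. (1 - h) * x0 + h * x1 + p (0::nat)"
    and "X1 \<equiv> \<lambda>x0 x1 q. h * x0 + (1 - h) * x1 + q (d::nat)"
  assumes "1 \<le> d"
  shows "storage h d (X0 x0 x1 p) (X1 x0 x1 q) (\<lambda>b. p (Suc b)) (\<lambda>b. q (Suc b)) =
     storage h d x0 x1 p q - 2 * h * (1 - h) * (x0 - x1)\<^sup>2 - (q 0)\<^sup>2
     + 2 * (p d * out_I h d x0 x1 p + q d * out_O h d x0 x1 p)
     + (p d)\<^sup>2 + 2 * (q d)\<^sup>2 + 2 * offdiag_pow h d * p d * q d"
proof -
  define S where "S = (\<Sum>b<d. (diag_pow h (Suc b) * x0 + offdiag_pow h (Suc b) * x1) * p b)"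
  define S' where "S' = (\<Sum>b<d. (diag_pow h (Suc (Suc b)) * x0 + offdiag_pow h (Suc (Suc b)) * x1) * p (Suc b))"
  define T where "T = (\<Sum>b<d. \<Sum>c<d. dist_kernel h b c * p b * p c)"
  define T' where "T' = (\<Sum>b<d. \<Sum>c<d. dist_kernel h b c * p (Suc b) * p (Suc c))"
  define L where "L = (\<Sum>b<d. diag_pow h (d - b) * p b)"
  define K where "K = (\<Sum>b<d. diag_pow h (Suc b) * p (Suc b))"
  define R where "R = (\<Sum>b<d. offdiag_pow h b * p b)"
  define R' where "R' = (\<Sum>b<d. offdiag_pow h (Suc b) * p (Suc b))"
  \<comment> \<open>A shift of the summation index: the term at 0 leaves and the term at
    \<open>d\<close> enters. The equations for \<open>q\<close> and \<open>R'\<close> arise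
    likewise.\<close>
  have S': "S' = S + (diag_pow h (Suc d) * x0 + offdiag_pow h (Suc d) * x1) * p d
      - ((1 - h) * x0 + h * x1) * p 0"
    using sum.lessThan_Suc[of "\<lambda>b. (diag_pow h (Suc b) * x0 + offdiag_pow h (Suc b) * x1) * p b" d]
      sum.lessThan_Suc_shift[of "\<lambda>b. (diag_pow h (Suc b) * x0 + offdiag_pow h (Suc b) * x1) * p b" d]
    by (simp add: S_def S'_def diag_pow_Suc[of h 0] offdiag_pow_Suc[of h 0])
  have q: "(\<Sum>b<d. (q (Suc b))\<^sup>2) = (\<Sum>b<d. (q b)\<^sup>2) + (q d)\<^sup>2 - (q 0)\<^sup>2"
    using sum.lessThan_Suc[of "\<lambda>b. (q b)\<^sup>2" d] sum.lessThan_Suc_shift[of "\<lambda>b. (q b)\<^sup>2" d] by simp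
  have R': "R' = R + offdiag_pow h d * p d"
    using sum.lessThan_Suc[of "\<lambda>b. offdiag_pow h b * p b" d]
      sum.lessThan_Suc_shift[of "\<lambda>b. offdiag_pow h b * p b" d]
    by (simp add: R_def R'_def)
  \<comment> \<open>The double sum over \<open>d + 1\<close> indices is evaluated twice, by peeling
    off the last index and by peeling off index 0. Since the kernel is invariant under a common
    shift, the remainders are \<open>T\<close> and \<open>T'\<close>, and comparison yields
    \<open>T'\<close>.\<close>
  have "(\<Sum>b<Suc d. \<Sum>c<Suc d. dist_kernel h b c * p b * p c) =
      T + (\<Sum>b<d. dist_kernel h b d * p b * p d) + (\<Sum>c<d. dist_kernel h d c * p d * p c) + (p d)\<^sup>2"
    by (simp add: T_def sum.distrib power2_eq_square)
  also have "(\<Sum>b<d. dist_kernel h b d * p b * p d) = p d * L"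
    by (auto simp: L_def dist_kernel_def sum_distrib_left mult_ac intro!: sum.cong)
  also have "(\<Sum>b<d. dist_kernel h d b * p d * p b) = p d * L"
    by (auto simp: L_def dist_kernel_def sum_distrib_left mult_ac intro!: sum.cong)
  finally have T1: "(\<Sum>b<Suc d. \<Sum>c<Suc d. dist_kernel h b c * p b * p c) = T + 2 * p d * L + (p d)\<^sup>2"
    by simp
  have "(\<Sum>b<Suc d. \<Sum>c<Suc d. dist_kernel h b c * p b * p c) =
      (p 0)\<^sup>2 + (\<Sum>c<d. dist_kernel h 0 (Suc c) * p 0 * p (Suc c))
      + (\<Sum>b<d. dist_kernel h (Suc b) 0 * p (Suc b) * p 0) + T'"
    by (simp add: T'_def sum.distrib power2_eq_square sum.lessThan_Suc_shift del: sum.lessThan_Suc)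
  also have "(\<Sum>c<d. dist_kernel h 0 (Suc c) * p 0 * p (Suc c)) = p 0 * K"
    by (auto simp: K_def dist_kernel_def sum_distrib_left mult_ac intro!: sum.cong)
  also have "(\<Sum>b<d. dist_kernel h (Suc b) 0 * p (Suc b) * p 0) = p 0 * K"
    by (auto simp: K_def dist_kernel_def sum_distrib_left mult_ac intro!: sum.cong)
  finally have T': "T' = T + 2 * p d * L + (p d)\<^sup>2 - (p 0)\<^sup>2 - 2 * p 0 * K"
    unfolding T1 by (simp add: algebra_simps)
  \<comment> \<open>Multiplying the coefficient row by \<open>A\<close> raises the power by one,
    which gives \<open>S'\<close>. The term \<open>p 0 * K\<close> will cancel against the one in
    \<open>T'\<close>, and \<open>R'\<close> supplies the product of \<open>p d\<close> and
    \<open>q d\<close>.\<close>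
  have mix: "(\<Sum>b<d. (diag_pow h (Suc b) * X0 x0 x1 p + offdiag_pow h (Suc b) * X1 x0 x1 q) * p (Suc b))
      = S' + p 0 * K + q d * R'"
    unfolding S'_def K_def R'_def sum_distrib_left sum.distrib[symmetric] X0_def X1_def
    by (intro sum.cong) (simp_all add: diag_pow_Suc[of h "Suc _"] offdiag_pow_Suc[of h "Suc _"] algebra_simps)
  show ?thesis
    unfolding storage_def mix T'_def[symmetric] q
    unfolding S_def[symmetric] T_def[symmetric] S' T' R' out_I_def out_O_def L_def[symmetric] R_def[symmetric]
    by (simp add: X0_def X1_def power2_eq_square algebra_simps)
qed

text \<open>\<open>gamma_m\<close> is the largest eigenvalue of the matrix of this quadratic form.\<close>

lemma gamma_m_bound:
  "(p\<^sup>2 + 2 * q\<^sup>2 + 2 * offdiag_pow h d * p * q) / 2 \<le> gamma_m h d * (p\<^sup>2 + q\<^sup>2)"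
proof -
  define s where "s = 2 * offdiag_pow h d"
  have s: "s = 1 - (1 - 2 * h) ^ d" by (simp add: s_def offdiag_pow_def field_simps)
  define w where "w = sqrt (1 + s\<^sup>2)"
  have w: "w\<^sup>2 = 1 + s\<^sup>2" "1 \<le> w" by (simp_all add: w_def)
  have g: "gamma_m h d = (3 + w) / 4"
    unfolding gamma_m_def w_def s by (simp add: power2_commute[of 1])
  \<comment> \<open>Four times the difference of the two sides is a form that becomes this square
    after multiplication by \<open>w + 1\<close>, because \<open>w^2 - 1 = s^2\<close>.\<close>
  have "0 \<le> ((w + 1) * p - s * q)\<^sup>2"
    by simp
  also have "\<dots> = (w + 1) * ((w + 1) * p\<^sup>2 + (w - 1) * q\<^sup>2 - 2 * s * p * q)"
    using w(1) by (simp add: power2_eq_square algebra_simps) algebra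
  finally have "0 \<le> (w + 1) * p\<^sup>2 + (w - 1) * q\<^sup>2 - 2 * s * p * q"
    using w(2) by (simp add: zero_le_mult_iff)
  then show ?thesis by (simp add: g s_def field_simps)
qed

text \<open>The two nonpositive terms of \<open>storage_step\<close> are dropped, one of them by
  \<open>0 \<le> h\<close> and \<open>h \<le> 1\<close>, and the terms quadratic in the new input
  are bounded by \<open>gamma_m_bound\<close>.\<close>

lemma storage_dissipation:
  assumes "1 \<le> d" "0 \<le> h" "h \<le> 1"
  shows "storage h d ((1 - h) * x0 + h * x1 + p 0) (h * x0 + (1 - h) * x1 + q d)
      (\<lambda>b. p (Suc b)) (\<lambda>b. q (Suc b)) / 2
    \<le> storage h d x0 x1 p q / 2 + (p d * out_I h d x0 x1 p + q d * out_O h d x0 x1 p)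
      + gamma_m h d * ((p d)\<^sup>2 + (q d)\<^sup>2)"
proof -
  have arith: "(S - E - F + 2 * Y + a + 2 * b + c) / 2 \<le> S / 2 + Y + G"
    if "(a + 2 * b + c) / 2 \<le> G" "0 \<le> E" "0 \<le> F" for S E F Y G a b c :: real
    using that by (simp add: field_simps)
  show ?thesis
    unfolding storage_step[OF assms(1)] using assms by (intro arith gamma_m_bound) simp_all
qed

subsection \<open>Conditional law of the actuators\<close>

text \<open>
  Instantiated both with essential boundedness and with measurability with respect to the state
  algebra, so that the closure of the closed-loop signals under the system equations is proved once.
\<close>

locale function_algebra =
  fixes M :: "'w measure" and P :: "('w \<Rightarrow> real) \<Rightarrow> bool"
  assumes const: "P (\<lambda>_. c)"
    and add: "P f \<Longrightarrow> P g \<Longrightarrow> P (\<lambda>\<omega>. f \<omega> + g \<omega>)"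
    and mult: "P f \<Longrightarrow> P g \<Longrightarrow> P (\<lambda>\<omega>. f \<omega> * g \<omega>)"
    and cong: "(\<And>\<omega>. \<omega> \<in> space M \<Longrightarrow> f \<omega> = g \<omega>) \<Longrightarrow> P f \<longleftrightarrow> P g"
begin

lemma uminus: "P f \<Longrightarrow> P (\<lambda>\<omega>. - f \<omega>)"
  using mult[OF const[of "-1"], of f] by simp

lemma diff: "P f \<Longrightarrow> P g \<Longrightarrow> P (\<lambda>\<omega>. f \<omega> - g \<omega>)"
  using add[OF _ uminus, of f g] by simp

lemma sum: "(\<And>i. i \<in> I \<Longrightarrow> P (f i)) \<Longrightarrow> P (\<lambda>\<omega>. \<Sum>i\<in>I. f i \<omega>)"
  by (induction I rule: infinite_finite_induct) (simp_all add: const add)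

lemmas intros = const add mult uminus diff sum

end

section \<open>The two function algebras: measurable and essentially bounded functions\<close>

lemma function_algebra_measurable:
  assumes "space F = space M"
  shows "function_algebra M (\<lambda>f. f \<in> borel_measurable F)"
proof
  fix f g :: "'a \<Rightarrow> real" assume "\<And>\<omega>. \<omega> \<in> space M \<Longrightarrow> f \<omega> = g \<omega>"
  then show "f \<in> borel_measurable F \<longleftrightarrow> g \<in> borel_measurable F"
    using assms by (intro measurable_cong) simp
qed auto

text \<open>The bound is required only almost everywhere because the conditional law confines an
  actuator output to its three values only up to a null set.\<close>

definition ess_bounded :: "'w measure \<Rightarrow> ('w \<Rightarrow> real) \<Rightarrow> bool" where
  "ess_bounded M f \<longleftrightarrow> f \<in> borel_measurable M \<and> (\<exists>C. AE \<omega> in M. \<bar>f \<omega>\<bar> \<le> C)"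

lemma ess_boundedI: "f \<in> borel_measurable M \<Longrightarrow> AE \<omega> in M. \<bar>f \<omega>\<bar> \<le> C \<Longrightarrow> ess_bounded M f"
  by (auto simp: ess_bounded_def)

lemma ess_bounded_measurable: "ess_bounded M f \<Longrightarrow> f \<in> borel_measurable M"
  by (simp add: ess_bounded_def)

lemma ess_bounded_cong:
  "(\<And>\<omega>. \<omega> \<in> space M \<Longrightarrow> f \<omega> = g \<omega>) \<Longrightarrow> ess_bounded M f \<longleftrightarrow> ess_bounded M g"
  unfolding ess_bounded_def by (auto cong: measurable_cong AE_cong)

lemma ess_bounded_const [simp]: "ess_bounded M (\<lambda>_. c)"
  by (rule ess_boundedI[where C = "\<bar>c\<bar>"]) auto

lemma ess_bounded_add:
  assumes "ess_bounded M f" "ess_bounded M g"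
  shows "ess_bounded M (\<lambda>\<omega>. f \<omega> + g \<omega>)"
proof -
  obtain C D where "AE \<omega> in M. \<bar>f \<omega>\<bar> \<le> C" "AE \<omega> in M. \<bar>g \<omega>\<bar> \<le> D"
    using assms by (auto simp: ess_bounded_def)
  then have "AE \<omega> in M. \<bar>f \<omega> + g \<omega>\<bar> \<le> C + D"
    by eventually_elim linarith
  moreover have "(\<lambda>\<omega>. f \<omega> + g \<omega>) \<in> borel_measurable M"
    using assms by (auto simp: ess_bounded_def)
  ultimately show ?thesis by (blast intro: ess_boundedI)
qed

lemma ess_bounded_mult:
  assumes "ess_bounded M f" "ess_bounded M g"
  shows "ess_bounded M (\<lambda>\<omega>. f \<omega> * g \<omega>)"
proof -
  obtain C D where "AE \<omega> in M. \<bar>f \<omega>\<bar> \<le> C" "AE \<omega> in M. \<bar>g \<omega>\<bar> \<le> D"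
    using assms by (auto simp: ess_bounded_def)
  then have "AE \<omega> in M. \<bar>f \<omega> * g \<omega>\<bar> \<le> C * D"
    by eventually_elim (simp add: abs_mult mult_mono')
  moreover have "(\<lambda>\<omega>. f \<omega> * g \<omega>) \<in> borel_measurable M"
    using assms by (auto simp: ess_bounded_def)
  ultimately show ?thesis by (blast intro: ess_boundedI)
qed

lemma function_algebra_ess_bounded: "function_algebra M (ess_bounded M)"
  by standard (simp_all add: ess_bounded_const ess_bounded_add ess_bounded_mult cong: ess_bounded_cong)

lemma (in finite_measure) integrable_ess_bounded: "ess_bounded M f \<Longrightarrow> integrable M f"
  unfolding ess_bounded_def by (metis (no_types, lifting) integrable_const_bound real_norm_def AE_cong)

section \<open>Moments and conditional law of an actuator\<close>

lemma expectation_actuator: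
  assumes "c \<in> {-1..1}"
  shows "measure_pmf.expectation (actuator c) f = \<bar>c\<bar> * f (sgn c) + (1 - \<bar>c\<bar>) * (f 0 :: real)"
  using assms by (simp add: actuator_def abs_le_iff)

context finite_measure_subalgebra
begin

text \<open>The conditional probabilities of -1, 0 and 1 add up to one. After integration the three
  disjoint events carry the whole mass of the space, so \<open>X\<close> takes other values only on
  a null set.\<close>

lemma actuator_law_support:
  assumes X [measurable]: "X \<in> borel_measurable M"
    and c: "\<And>\<omega>. \<omega> \<in> space M \<Longrightarrow> c \<omega> \<in> {-1..1}"
    and law: "\<And>a. a \<in> {-1, 0, 1} \<Longrightarrow> AE \<omega> in M.
      real_cond_exp M F (indicator {\<omega> \<in> space M. X \<omega> = a}) \<omega> = pmf (actuator (c \<omega>)) a"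
  shows "AE \<omega> in M. X \<omega> \<in> {-1, 0, 1}"
proof -
  define S where "S a = {\<omega> \<in> space M. X \<omega> = a}" for a
  have S [measurable]: "S a \<in> sets M" for a
    by (simp add: S_def)
  let ?f = "\<lambda>\<omega>. indicat_real (S (-1)) \<omega> + (indicat_real (S 0) \<omega> + indicat_real (S 1) \<omega>)"
  have int: "integrable M (indicat_real (S a))" for a
    by (simp add: integrable_indicator_iff less_top[symmetric])
  note law' = law[OF insertI1, folded S_def] law[OF insertI2[OF insertI1], folded S_def]
    law[OF insertI2[OF insertI2[OF insertI1]], folded S_def]
  have total: "pmf (actuator (c \<omega>)) (-1) + (pmf (actuator (c \<omega>)) 0 + pmf (actuator (c \<omega>)) 1) = 1"
    if "\<omega> \<in> space M" for \<omega>
    using pmf_actuator[OF c[OF that]] by auto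
  have "AE \<omega> in M. real_cond_exp M F ?f \<omega> = 1"
    using real_cond_exp_add[OF int Bochner_Integration.integrable_add[OF int int], of "-1" 0 1]
      real_cond_exp_add[OF int int, of 0 1]
      law' AE_space
    by eventually_elim (use total in auto)
  then have "(\<integral>\<omega>. real_cond_exp M F ?f \<omega> \<partial>M) = (\<integral>\<omega>. 1 \<partial>M)"
    by (intro integral_cong_AE) auto
  then have "(\<integral>\<omega>. 1 - ?f \<omega> \<partial>M) = 0"
    using real_cond_exp_int(2)[of ?f] int by simp
  moreover have "0 \<le> 1 - ?f \<omega>" for \<omega>
    by (auto simp: S_def indicator_def)
  ultimately have "AE \<omega> in M. 1 - ?f \<omega> = 0"
    using int by (subst (asm) integral_nonneg_eq_0_iff_AE) auto
  with AE_space show ?thesis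
    by eventually_elim (auto simp: S_def indicator_def split: if_splits)
qed

text \<open>\<open>c\<close> is not assumed measurable: it agrees almost everywhere with a conditional expectation.\<close>

lemma actuator_law_cond_exp:
  assumes X [measurable]: "X \<in> borel_measurable M"
    and c: "\<And>\<omega>. \<omega> \<in> space M \<Longrightarrow> c \<omega> \<in> {-1..1}"
    and law: "\<And>a. a \<in> {-1, 0, 1} \<Longrightarrow> AE \<omega> in M.
      real_cond_exp M F (indicator {\<omega> \<in> space M. X \<omega> = a}) \<omega> = pmf (actuator (c \<omega>)) a"
    and v: "v \<in> borel_measurable F" "ess_bounded M v"
  shows "AE \<omega> in M. real_cond_exp M F (\<lambda>\<omega>. k * (X \<omega>)\<^sup>2 - X \<omega> * v \<omega>) \<omega> = k * \<bar>c \<omega>\<bar> - c \<omega> * v \<omega>"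
proof -
  define S where "S a = {\<omega> \<in> space M. X \<omega> = a}" for a
  have S [measurable]: "S a \<in> sets M" for a
    by (simp add: S_def)
  have vM [measurable]: "v \<in> borel_measurable M"
    using v(2) by (rule ess_bounded_measurable)
  note vF [measurable] = v(1)
  note law' = law[OF insertI1, folded S_def] law[OF insertI2[OF insertI1], folded S_def]
    law[OF insertI2[OF insertI2[OF insertI1]], folded S_def]
  have ind: "ess_bounded M (indicat_real (S a))" for a
    by (rule ess_boundedI[where C = 1]) auto
  interpret B: function_algebra M "ess_bounded M"
    by (rule function_algebra_ess_bounded)
  have p: "integrable M (\<lambda>\<omega>. (k - v \<omega>) * indicat_real (S 1) \<omega>)"
    and m: "integrable M (\<lambda>\<omega>. (k + v \<omega>) * indicat_real (S (-1)) \<omega>)"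
    by (intro integrable_ess_bounded B.intros v ind)+
  have support: "AE \<omega> in M. X \<omega> \<in> {-1, 0, 1}"
    using X c law by (rule actuator_law_support)
  \<comment> \<open>On the support the integrand is \<open>k - v\<close> where \<open>X = 1\<close>,
    \<open>k + v\<close> where \<open>X = -1\<close> and 0 elsewhere; these coefficients are
    \<open>F\<close>-measurable and can leave the conditional expectation.\<close>
  have "AE \<omega> in M. k * (X \<omega>)\<^sup>2 - X \<omega> * v \<omega> =
      (k - v \<omega>) * indicat_real (S 1) \<omega> + (k + v \<omega>) * indicat_real (S (-1)) \<omega>"
    using support AE_space by eventually_elim (auto simp: S_def)
  then have "AE \<omega> in M. real_cond_exp M F (\<lambda>\<omega>. k * (X \<omega>)\<^sup>2 - X \<omega> * v \<omega>) \<omega> =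
      real_cond_exp M F (\<lambda>\<omega>. (k - v \<omega>) * indicat_real (S 1) \<omega> + (k + v \<omega>) * indicat_real (S (-1)) \<omega>) \<omega>"
    by (rule real_cond_exp_cong) measurable
  moreover have "AE \<omega> in M. real_cond_exp M F (\<lambda>\<omega>. (k - v \<omega>) * indicat_real (S 1) \<omega>) \<omega> =
      (k - v \<omega>) * real_cond_exp M F (indicat_real (S 1)) \<omega>"
    by (rule real_cond_exp_mult) (use p in auto)
  moreover have "AE \<omega> in M. real_cond_exp M F (\<lambda>\<omega>. (k + v \<omega>) * indicat_real (S (-1)) \<omega>) \<omega> =
      (k + v \<omega>) * real_cond_exp M F (indicat_real (S (-1))) \<omega>"
    by (rule real_cond_exp_mult) (use m in auto)
  moreover note real_cond_exp_add[OF p m] law' AE_space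
  ultimately show ?thesis
  proof eventually_elim
    case (elim \<omega>)
    then show ?case
      using pmf_actuator[OF c[of \<omega>]] by (auto simp: max_def abs_if algebra_simps)
  qed
qed

end

section \<open>The algebra generated by the extended states\<close>

lemma state_algebra_space [simp]: "space (state_algebra M N d \<xi>) = space M"
  by (auto simp: state_algebra_def space_measure_of_conv)

lemma measurable_state_algebra:
  assumes "i < N" "p < 2 * (d i + 1)"
  shows "(\<lambda>\<omega>. \<xi> i \<omega> $ p) \<in> borel_measurable (state_algebra M N d \<xi>)"
proof (rule measurableI)
  fix S :: "real set" assume "S \<in> sets borel"
  with assms show "(\<lambda>\<omega>. \<xi> i \<omega> $ p) -` S \<inter> space (state_algebra M N d \<xi>) \<in> sets (state_algebra M N d \<xi>)"
    unfolding state_algebra_space unfolding state_algebra_def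
    by (subst sets_measure_of) (auto intro!: sigma_sets.Basic)
qed auto

lemma subalgebra_state_algebra:
  assumes "\<And>i p. i < N \<Longrightarrow> p < 2 * (d i + 1) \<Longrightarrow> (\<lambda>\<omega>. \<xi> i \<omega> $ p) \<in> borel_measurable M"
  shows "subalgebra M (state_algebra M N d \<xi>)"
  unfolding subalgebra_def state_algebra_space
proof
  show "sets (state_algebra M N d \<xi>) \<subseteq> sets M"
    unfolding state_algebra_def using assms
    by (subst sets_measure_of) (auto intro!: sets.sigma_sets_subset measurable_sets)
qed simp

text \<open>The actuator law is conditioned on the state, the conclusion on its deviation from
  equilibrium. The two differ by constants, and translates of Borel sets are Borel, so both generate
  the same algebra.\<close>

lemma state_algebra_translate:
  assumes "\<And>i p \<omega>. i < N \<Longrightarrow> p < 2 * (d i + 1) \<Longrightarrow> \<omega> \<in> space M \<Longrightarrow> \<xi> i \<omega> $ p = \<eta> i \<omega> $ p + e i p"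
  shows "state_algebra M N d \<xi> = state_algebra M N d \<eta>"
proof -
  \<comment> \<open>Stated for arbitrary families so that it serves both inclusions, the second one
    with offset \<open>- e\<close>.\<close>
  have sub: "{(\<lambda>\<omega>. \<xi> i \<omega> $ p) -` S \<inter> space M | i p S. i < N \<and> p < 2 * (d i + 1) \<and> S \<in> sets borel}
      \<subseteq> {(\<lambda>\<omega>. \<eta> i \<omega> $ p) -` S \<inter> space M | i p S. i < N \<and> p < 2 * (d i + 1) \<and> S \<in> sets borel}"
    if *: "\<And>i p \<omega>. i < N \<Longrightarrow> p < 2 * (d i + 1) \<Longrightarrow> \<omega> \<in> space M \<Longrightarrow> \<xi> i \<omega> $ p = \<eta> i \<omega> $ p + e i p"
    for \<xi> \<eta> :: "nat \<Rightarrow> 'a \<Rightarrow> real vec" and e :: "nat \<Rightarrow> nat \<Rightarrow> real"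
  proof safe
    fix i p and S :: "real set" assume i: "i < N" "p < 2 * (d i + 1)" and S: "S \<in> sets borel"
    have "(\<lambda>r. r + e i p) -` S \<inter> space borel \<in> sets borel"
      using S by (intro measurable_sets) auto
    moreover have "(\<lambda>\<omega>. \<xi> i \<omega> $ p) -` S \<inter> space M =
        (\<lambda>\<omega>. \<eta> i \<omega> $ p) -` ((\<lambda>r. r + e i p) -` S) \<inter> space M"
      using *[OF i] by auto
    ultimately show "\<exists>i' p' S'. (\<lambda>\<omega>. \<xi> i \<omega> $ p) -` S \<inter> space M = (\<lambda>\<omega>. \<eta> i' \<omega> $ p') -` S' \<inter> space M
        \<and> i' < N \<and> p' < 2 * (d i' + 1) \<and> S' \<in> sets borel"
      using i by auto
  qed
  have "\<eta> i \<omega> $ p = \<xi> i \<omega> $ p + - e i p" if "i < N" "p < 2 * (d i + 1)" "\<omega> \<in> space M" for i p \<omega>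
    using assms[OF that] by simp
  from equalityI[OF sub[OF assms] sub[OF this]] show ?thesis
    unfolding state_algebra_def by simp
qed

subsection \<open>The interconnected system\<close>

lemma ext_state_carrier [simp]: "ext_state d x u t \<in> carrier_vec (2 * (d + 1))"
  by (simp add: ext_state_def stack2_def)

text \<open>The truncated \<open>p div 2 - 1\<close> is harmless, as \<open>2 \<le> p\<close> in its
  branch.\<close>

lemma ext_state_index:
  assumes "p < 2 * (d + 1)"
  shows "ext_state d x u t $ p =
    (if p < 2 then x $ p else u (t - int d + int (p div 2 - 1)) $ (p mod 2))"
  using assms
  by (auto simp: ext_state_def stack2_def div_eq_0_iff of_nat_diff algebra_simps Suc_le_eq
      dest: div_greater_zero_iff[THEN iffD2])

lemma ext_state_input_index:
  assumes "b < d"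
  shows "ext_state d x u t $ (2 * Suc b) = u (t - int d + int b) $ 0"
    and "ext_state d x u t $ (2 * Suc b + 1) = u (t - int d + int b) $ 1"
proof -
  show "ext_state d x u t $ (2 * Suc b) = u (t - int d + int b) $ 0"
    using assms by (simp add: ext_state_index del: mult_Suc_right)
  have idx: "(2 * Suc b + 1) div 2 - 1 = b" "(2 * Suc b + 1) mod 2 = 1"
    by presburger+
  have "2 * Suc b + 1 < 2 * (d + 1)"
    using assms by simp
  from ext_state_index[OF this, of x u t, unfolded idx]
  show "ext_state d x u t $ (2 * Suc b + 1) = u (t - int d + int b) $ 1"
    by simp
qed

lemma ext_state_translate:
  assumes "p < 2 * (d + 1)"
  shows "ext_state d (x - e \<cdot>\<^sub>v ones_vec 2) u t $ p = ext_state d x u t $ p + (if p < 2 then - e else 0)"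
  using assms by (simp add: ext_state_index ones_vec_def)

lemma Omega_mat_quadratic_form_ext_state:
  "ext_state d x u t \<bullet> (Omega_mat h d *\<^sub>v ext_state d x u t) =
    storage h d (x $ 0) (x $ 1) (\<lambda>b. u (t - int d + int b) $ 0) (\<lambda>b. u (t - int d + int b) $ 1)"
proof -
  have "storage h d (x $ 0) (x $ 1) (\<lambda>b. ext_state d x u t $ (2 * Suc b)) (\<lambda>b. ext_state d x u t $ (2 * Suc b + 1))
    = storage h d (x $ 0) (x $ 1) (\<lambda>b. u (t - int d + int b) $ 0) (\<lambda>b. u (t - int d + int b) $ 1)"
    unfolding storage_def
    by (intro arg_cong2[where f = "(+)"] arg_cong2[where f = "(*)"] sum.cong refl)
       (simp_all only: lessThan_iff ext_state_input_index)
  moreover have "ext_state d x u t $ 0 = x $ 0" "ext_state d x u t $ 1 = x $ 1"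
    by (simp_all add: ext_state_index)
  ultimately show ?thesis
    by (simp only: Omega_mat_quadratic_form[OF ext_state_carrier])
qed

text \<open>\<open>A_mat h\<close> fixes the all-one vector, so the deviation obeys the plant
  equation too, and the outputs drop by \<open>e\<close> by \<open>out_translate\<close>. Then
  \<open>storage_dissipation\<close> applies, with index \<open>d\<close> for the present
  input.\<close>

lemma process_dissipation:
  fixes e :: real
  assumes d: "1 \<le> d" and h: "0 \<le> h" "h \<le> 1" and x: "x \<in> carrier_vec 2"
    and u: "\<And>b. b \<le> d \<Longrightarrow> u (t - int d + int b) \<in> carrier_vec 2"
  defines "\<xi> \<equiv> ext_state d (x - e \<cdot>\<^sub>v ones_vec 2) u t"
    and "\<xi>' \<equiv> ext_state d (A_mat h *\<^sub>v x + B_O *\<^sub>v u t + B_I *\<^sub>v u (t - int d) - e \<cdot>\<^sub>v ones_vec 2) u (t + 1)"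
  shows "1 / 2 * (\<xi>' \<bullet> (Omega_mat h d *\<^sub>v \<xi>')) \<le> 1 / 2 * (\<xi> \<bullet> (Omega_mat h d *\<^sub>v \<xi>))
    + (u t $ 0 * (comp_out h d x u t $ 0 - e) + u t $ 1 * (comp_out h d x u t $ 1 - e))
    + gamma_m h d * ((u t $ 0)\<^sup>2 + (u t $ 1)\<^sup>2)"
proof -
  let ?p = "\<lambda>b. u (t - int d + int b) $ 0" and ?q = "\<lambda>b. u (t - int d + int b) $ 1"
  let ?z = "A_mat h *\<^sub>v x + B_O *\<^sub>v u t + B_I *\<^sub>v u (t - int d) - e \<cdot>\<^sub>v ones_vec 2"
  have ut: "u t \<in> carrier_vec 2" "u (t - int d) \<in> carrier_vec 2"
    using u[of d] u[of 0] by simp_all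
  have z: "?z $ 0 = (1 - h) * (x $ 0 - e) + h * (x $ 1 - e) + ?p 0"
    "?z $ 1 = h * (x $ 0 - e) + (1 - h) * (x $ 1 - e) + ?q d"
    using x ut
    by (simp_all add: ones_vec_def mult_mat_vec_2[OF A_mat_carrier] mult_mat_vec_2[OF B_O_carrier]
        mult_mat_vec_2[OF B_I_carrier] algebra_simps del: index_mult_mat_vec(1))
  have xe: "(x - e \<cdot>\<^sub>v ones_vec 2) $ 0 = x $ 0 - e" "(x - e \<cdot>\<^sub>v ones_vec 2) $ 1 = x $ 1 - e"
    by (simp_all add: ones_vec_def)
  have shift: "t + 1 - int d + int b = t - int d + int (Suc b)" for b
    by simp
  have "comp_out h d x u t $ 0 - e = out_I h d (x $ 0 - e) (x $ 1 - e) ?p"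
    "comp_out h d x u t $ 1 - e = out_O h d (x $ 0 - e) (x $ 1 - e) ?p"
    using comp_out_index[OF d x, of u t h] u by (simp_all add: out_translate)
  moreover have "u t $ 0 = ?p d" "u t $ 1 = ?q d"
    by simp_all
  ultimately show ?thesis
    unfolding \<xi>_def \<xi>'_def Omega_mat_quadratic_form_ext_state z xe shift
    using storage_dissipation[OF d h, of "x $ 0 - e" "x $ 1 - e" ?p ?q] by simp
qed

section \<open>The incidence matrix and the exchange of power along the routes\<close>

lemma incidence_carrier [simp]: "incidence N \<in> carrier_mat (2 * N) N"
  by (simp add: incidence_def)

lemma incidence_dims [simp]: "dim_row (incidence N) = 2 * N" "dim_col (incidence N) = N"
  by (simp_all add: incidence_def)

lemma incidence_column_sum:
  assumes "r < N"
  shows "(\<Sum>p<2 * N. incidence N $$ (p, r)) = 0"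
proof -
  \<comment> \<open>One position is odd and the other even, so they differ even for
    \<open>N = 1\<close>; this turns the nested conditional into a sum.\<close>
  have odd: "2 * r + 1 \<noteq> 2 * ((r + 1) mod N)"
  proof
    assume "2 * r + 1 = 2 * ((r + 1) mod N)"
    then have "even (2 * r + 1)"
      by (metis dvd_triv_left)
    then show False
      by simp
  qed
  have lt: "(r + 1) mod N < N"
    using assms by simp
  have "(\<Sum>p<2 * N. incidence N $$ (p, r)) =
      (\<Sum>p<2 * N. (if p = 2 * r + 1 then - 1 else 0) + (if p = 2 * ((r + 1) mod N) then 1 else 0))"
    using assms odd by (intro sum.cong) (auto simp: incidence_def)
  also have "\<dots> = 0"
    using assms lt by (simp add: sum.distrib sum.delta)
  finally show ?thesis .
qed

text \<open>Pairing \<open>B a\<close> with the outputs is pairing \<open>a\<close> with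
  \<open>B^T Y\<close>; the offset \<open>e\<close> vanishes because the columns of \<open>B\<close>
  sum to zero. The two minus signs match the sign convention of \<open>y_c\<close>.\<close>

lemma incidence_power_balance:
  fixes N :: nat and a :: "nat \<Rightarrow> real" and e :: real
  defines "w \<equiv> incidence N *\<^sub>v vec N a"
  shows "(\<Sum>i<N. w $ (2 * i) * (Y i $ 0 - e) + w $ (2 * i + 1) * (Y i $ 1 - e)) =
    - (\<Sum>r<N. a r * (- ((incidence N)\<^sup>T *\<^sub>v stack2 N Y)) $ r)"
proof -
  have w: "w $ p = (\<Sum>r<N. incidence N $$ (p, r) * a r)" if "p < 2 * N" for p
    using that incidence_carrier[of N]
    by (auto simp: w_def scalar_prod_def atLeast0LessThan intro!: sum.cong)
  have yc: "((incidence N)\<^sup>T *\<^sub>v stack2 N Y) $ r = (\<Sum>p<2 * N. incidence N $$ (p, r) * stack2 N Y $ p)"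
    if "r < N" for r
    using that incidence_carrier[of N]
    by (auto simp: scalar_prod_def atLeast0LessThan stack2_def intro!: sum.cong)
  have "(\<Sum>i<N. w $ (2 * i) * (Y i $ 0 - e) + w $ (2 * i + 1) * (Y i $ 1 - e)) =
      (\<Sum>p<2 * N. w $ p * (stack2 N Y $ p - e))"
    unfolding sum_double by (intro sum.cong) (simp_all add: stack2_def)
  also have "\<dots> = (\<Sum>p<2 * N. \<Sum>r<N. a r * (incidence N $$ (p, r) * stack2 N Y $ p - e * incidence N $$ (p, r)))"
  proof (intro sum.cong refl)
    fix p assume "p \<in> {..<2 * N}"
    then show "w $ p * (stack2 N Y $ p - e) =
        (\<Sum>r<N. a r * (incidence N $$ (p, r) * stack2 N Y $ p - e * incidence N $$ (p, r)))"
      by (simp only: lessThan_iff w sum_distrib_right) (intro sum.cong; simp add: algebra_simps)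
  qed
  also have "\<dots> = (\<Sum>r<N. \<Sum>p<2 * N. a r * (incidence N $$ (p, r) * stack2 N Y $ p - e * incidence N $$ (p, r)))"
    by (rule sum.swap)
  also have "\<dots> = (\<Sum>r<N. a r * ((incidence N)\<^sup>T *\<^sub>v stack2 N Y) $ r)"
    using incidence_column_sum
    by (intro sum.cong)
       (simp_all add: yc sum_distrib_left[symmetric] sum_subtractf del: index_mult_mat_vec(1))
  also have "\<dots> = - (\<Sum>r<N. a r * (- ((incidence N)\<^sup>T *\<^sub>v stack2 N Y)) $ r)"
    using incidence_carrier[of N] by (simp add: sum_negf del: index_mult_mat_vec(1))
  finally show ?thesis .
qed

lemma mat_diag_carrier: "mat_diag n f \<in> carrier_mat n n"
  by (simp add: mat_diag_def)

lemma quadratic_form_mat_diag: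
  assumes "v \<in> carrier_vec n"
  shows "v \<bullet> (mat_diag n f *\<^sub>v v) = (\<Sum>p<n. f p * (v $ p :: real)\<^sup>2)"
  unfolding quadratic_form_sum[OF mat_diag_carrier assms]
  by (intro sum.cong) (auto simp: mat_diag_def power2_eq_square if_distrib if_distribR cong: if_cong)

text \<open>Evaluate the semidefinite form at \<open>v\<close> and move \<open>B\<close> across the
  scalar product. For the actuator outputs the left side becomes the quadratic input term weighted
  by \<open>gamma_m\<close>.\<close>

lemma psd_mat_diag_congruence:
  assumes psd: "psd_mat (mat_diag n \<delta> - B\<^sup>T * mat_diag m g * B)" and B: "B \<in> carrier_mat m n"
    and v: "v \<in> carrier_vec n"
  shows "(\<Sum>p<m. g p * ((B *\<^sub>v v) $ p)\<^sup>2) \<le> (\<Sum>r<n. \<delta> r * (v $ r)\<^sup>2)"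
proof -
  let ?G = "mat_diag m g" and ?D = "mat_diag n \<delta>"
  have G: "?G \<in> carrier_mat m m" and D: "?D \<in> carrier_mat n n"
    by (rule mat_diag_carrier)+
  have BT: "B\<^sup>T \<in> carrier_mat n m"
    using B by simp
  have BTG: "B\<^sup>T * ?G \<in> carrier_mat n m"
    using BT G by (rule mult_carrier_mat)
  have M: "B\<^sup>T * ?G * B \<in> carrier_mat n n"
    using BTG B by (rule mult_carrier_mat)
  have Bv: "B *\<^sub>v v \<in> carrier_vec m"
    using B v by simp
  have "0 \<le> v \<bullet> ((?D - B\<^sup>T * ?G * B) *\<^sub>v v)"
    using psd v M by (auto simp: psd_mat_def)
  also have "\<dots> = v \<bullet> (?D *\<^sub>v v) - v \<bullet> (B\<^sup>T * ?G * B *\<^sub>v v)"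
    using v M D
    by (simp add: minus_mult_distrib_mat_vec[OF D M v]
        scalar_prod_minus_distrib[OF v mult_mat_vec_carrier[OF D v] mult_mat_vec_carrier[OF M v]])
  also have "B\<^sup>T * ?G * B *\<^sub>v v = B\<^sup>T *\<^sub>v (?G *\<^sub>v (B *\<^sub>v v))"
    by (simp add: assoc_mult_mat_vec[OF BTG B v] assoc_mult_mat_vec[OF BT G Bv])
  also have "v \<bullet> (B\<^sup>T *\<^sub>v (?G *\<^sub>v (B *\<^sub>v v))) = (B *\<^sub>v v) \<bullet> (?G *\<^sub>v (B *\<^sub>v v))"
    using transpose_vec_mult_scalar[OF B v mult_mat_vec_carrier[OF G Bv]] B G BT v Bv
      comm_scalar_prod[OF v mult_mat_vec_carrier[OF BT mult_mat_vec_carrier[OF G Bv]]]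
      comm_scalar_prod[OF Bv mult_mat_vec_carrier[OF G Bv]] by simp
  finally show ?thesis
    by (simp add: quadratic_form_mat_diag v Bv)
qed

text \<open>The output is linear in the components of the extended state. The hypothesis
  \<open>ext\<close> speaks of these components because they generate the state algebra.\<close>

lemma function_algebra_comp_out:
  assumes P: "function_algebra M P" and d: "1 \<le> d"
    and x: "\<And>\<omega>. \<omega> \<in> space M \<Longrightarrow> x \<omega> \<in> carrier_vec 2"
    and u: "\<And>b \<omega>. b < d \<Longrightarrow> \<omega> \<in> space M \<Longrightarrow> u \<omega> (t - int d + int b) \<in> carrier_vec 2"
    and ext: "\<And>p. p < 2 * (d + 1) \<Longrightarrow> P (\<lambda>\<omega>. ext_state d (x \<omega>) (u \<omega>) t $ p)"
    and c: "c < 2"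
  shows "P (\<lambda>\<omega>. comp_out h d (x \<omega>) (u \<omega>) t $ c)"
proof -
  interpret function_algebra M P by (rule P)
  have Px: "P (\<lambda>\<omega>. x \<omega> $ 0)" "P (\<lambda>\<omega>. x \<omega> $ 1)"
    using ext[of 0] ext[of 1] by (simp_all add: ext_state_index)
  have Pu: "P (\<lambda>\<omega>. u \<omega> (t - int d + int b) $ 0)" if "b < d" for b
    using ext[of "2 * Suc b"] that by (simp add: ext_state_input_index del: mult_Suc_right)
  have I: "P (\<lambda>\<omega>. out_I h d (x \<omega> $ 0) (x \<omega> $ 1) (\<lambda>b. u \<omega> (t - int d + int b) $ 0))"
    and O: "P (\<lambda>\<omega>. out_O h d (x \<omega> $ 0) (x \<omega> $ 1) (\<lambda>b. u \<omega> (t - int d + int b) $ 0))"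
    unfolding out_I_def out_O_def by (intro intros Px Pu; simp)+
  have "comp_out h d (x \<omega>) (u \<omega>) t $ 0 =
        out_I h d (x \<omega> $ 0) (x \<omega> $ 1) (\<lambda>b. u \<omega> (t - int d + int b) $ 0)"
    and "comp_out h d (x \<omega>) (u \<omega>) t $ 1 =
        out_O h d (x \<omega> $ 0) (x \<omega> $ 1) (\<lambda>b. u \<omega> (t - int d + int b) $ 0)"
    if "\<omega> \<in> space M" for \<omega>
    using comp_out_index[OF d x[OF that], of "u \<omega>" t h] u that by blast+
  from cong[OF this(1)] cong[OF this(2)] I O
  have "P (\<lambda>\<omega>. comp_out h d (x \<omega>) (u \<omega>) t $ 0)"
    and "P (\<lambda>\<omega>. comp_out h d (x \<omega>) (u \<omega>) t $ 1)"
    by simp_all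
  then show ?thesis
    using c by (auto simp: less_2_iff)
qed

lemma function_algebra_quadratic_form:
  assumes P: "function_algebra M P"
    and \<xi>: "\<And>\<omega>. \<omega> \<in> space M \<Longrightarrow> \<xi> \<omega> \<in> carrier_vec n" "\<And>p. p < n \<Longrightarrow> P (\<lambda>\<omega>. \<xi> \<omega> $ p)"
    and X: "X \<in> carrier_mat n n"
  shows "P (\<lambda>\<omega>. \<xi> \<omega> \<bullet> (X *\<^sub>v \<xi> \<omega>))"
proof -
  interpret function_algebra M P by (rule P)
  have "P (\<lambda>\<omega>. \<Sum>p<n. \<Sum>q<n. \<xi> \<omega> $ p * X $$ (p, q) * \<xi> \<omega> $ q)"
    by (intro intros \<xi>(2)) simp_all
  then show ?thesis
    by (subst cong[OF quadratic_form_sum[OF X \<xi>(1)]])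
qed

theorem proposition9:
  fixes M :: "'w measure"
    and N :: nat and h :: real and d :: "nat \<Rightarrow> nat"
    and x0 :: "nat \<Rightarrow> real vec" and u0 :: "nat \<Rightarrow> int \<Rightarrow> real vec"
    and Ctrl :: "nat \<Rightarrow> real \<Rightarrow> real" and \<delta> :: "nat \<Rightarrow> real"
    and x :: "nat \<Rightarrow> nat \<Rightarrow> 'w \<Rightarrow> real vec" and u :: "nat \<Rightarrow> int \<Rightarrow> 'w \<Rightarrow> real vec"
    and y :: "nat \<Rightarrow> nat \<Rightarrow> 'w \<Rightarrow> real vec" and y_c :: "nat \<Rightarrow> 'w \<Rightarrow> real vec"
    and u_c u_a :: "nat \<Rightarrow> nat \<Rightarrow> 'w \<Rightarrow> real"
    and xt :: "nat \<Rightarrow> nat \<Rightarrow> 'w \<Rightarrow> real vec"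
  assumes prob: "prob_space M"
    and N: "1 \<le> N"
    and h: "0 < h" "h < 1"
    and d: "\<And>i. i < N \<Longrightarrow> 1 \<le> d i"
    \<comment> \<open>given initial data\<close>
    and x0: "\<And>i. i < N \<Longrightarrow> x0 i \<in> carrier_vec 2"
    and u0: "\<And>i s. i < N \<Longrightarrow> - int (d i) \<le> s \<Longrightarrow> s < 0 \<Longrightarrow> u0 i s \<in> carrier_vec 2"
    and x_init: "\<And>i \<omega>. i < N \<Longrightarrow> \<omega> \<in> space M \<Longrightarrow> x i 0 \<omega> = x0 i"
    and u_init: "\<And>i s \<omega>. i < N \<Longrightarrow> - int (d i) \<le> s \<Longrightarrow> s < 0 \<Longrightarrow> \<omega> \<in> space M \<Longrightarrow> u i s \<omega> = u0 i s"
    \<comment> \<open>plant\<close>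
    and u_routes: "\<And>i t \<omega>. i < N \<Longrightarrow> \<omega> \<in> space M \<Longrightarrow>
          u i (int t) \<omega> = block2 i (incidence N *\<^sub>v vec N (\<lambda>r. u_a r t \<omega>))"
    and dynamics: "\<And>i t \<omega>. i < N \<Longrightarrow> \<omega> \<in> space M \<Longrightarrow>
          x i (t + 1) \<omega> = A_mat h *\<^sub>v x i t \<omega> + B_O *\<^sub>v u i (int t) \<omega> + B_I *\<^sub>v u i (int t - int (d i)) \<omega>"
    \<comment> \<open>delay compensators and feedback\<close>
    and compensator: "\<And>i t \<omega>. i < N \<Longrightarrow> \<omega> \<in> space M \<Longrightarrow>
          y i t \<omega> = comp_out h (d i) (x i t \<omega>) (\<lambda>s. u i s \<omega>) (int t)"
    and feedback: "\<And>t \<omega>. \<omega> \<in> space M \<Longrightarrow>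
          y_c t \<omega> = - ((incidence N)\<^sup>T *\<^sub>v stack2 N (\<lambda>i. y i t \<omega>))"
    and controller: "\<And>r t \<omega>. r < N \<Longrightarrow> \<omega> \<in> space M \<Longrightarrow> u_c r t \<omega> = Ctrl r (y_c t \<omega> $ r)"
    \<comment> \<open>stochastic actuators: conditional law of the actuator outputs\<close>
    and u_a_rv: "\<And>r t. r < N \<Longrightarrow> u_a r t \<in> borel_measurable M"
    and actuation: "\<And>r t a. r < N \<Longrightarrow> a \<in> {-1, 0, 1} \<Longrightarrow>
          AE \<omega> in M. real_cond_exp M
            (state_algebra M N d (\<lambda>i \<omega>. ext_state (d i) (x i t \<omega>) (\<lambda>s. u i s \<omega>) (int t)))
            (indicator {\<omega> \<in> space M. u_a r t \<omega> = a}) \<omega> = pmf (actuator (u_c r t \<omega>)) a"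
    \<comment> \<open>design conditions (i) and (ii)\<close>
    and ctrl_range: "\<And>r v. r < N \<Longrightarrow> Ctrl r v \<in> {-1..1}"
    and ctrl_passive: "\<And>r v. r < N \<Longrightarrow>
          measure_pmf.expectation (actuator (Ctrl r v)) (\<lambda>a. a * v)
            \<ge> \<delta> r * measure_pmf.expectation (actuator (Ctrl r v)) (\<lambda>a. a\<^sup>2)"
    and delta: "psd_mat (mat_diag N \<delta>
          - (incidence N)\<^sup>T * mat_diag (2 * N) (\<lambda>p. gamma_m h (d (p div 2))) * incidence N)"
    \<comment> \<open>extended deviation state\<close>
    and xt: "\<And>i t \<omega>. i < N \<Longrightarrow> \<omega> \<in> space M \<Longrightarrow>
          xt i t \<omega> = ext_state (d i) (x i t \<omega> - x_eq N x0) (\<lambda>s. u i s \<omega>) (int t)"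
  shows "\<forall>t. AE \<omega> in M.
          real_cond_exp M (state_algebra M N d (\<lambda>i. xt i t))
            (\<lambda>\<omega>. lyapunov h N d (\<lambda>i. xt i (t + 1) \<omega>)) \<omega>
          - lyapunov h N d (\<lambda>i. xt i t \<omega>) \<le> 0"
proof (intro allI)
  fix t
  interpret prob_space M by (rule prob)
  define e where "e = 1 / (2 * real N) * (ones_vec (2 * N) \<bullet> stack2 N x0)"
  \<comment> \<open>The extended state before the equilibrium is subtracted; the actuator law is
    conditioned on it.\<close>
  define ext where "ext i t \<omega> = ext_state (d i) (x i t \<omega>) (\<lambda>s. u i s \<omega>) (int t)" for i t \<omega>
  define F where "F t = state_algebra M N d (\<lambda>i. xt i t)" for t
  have x_eq: "x_eq N x0 = e \<cdot>\<^sub>v ones_vec 2"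
    by (simp add: x_eq_def e_def)

  \<comment> \<open>Dimensions and components of the loop signals\<close>
  have x_carrier: "x i t \<omega> \<in> carrier_vec 2" if "i < N" "\<omega> \<in> space M" for i t \<omega>
  proof (cases t)
    case 0
    with that show ?thesis by (simp add: x_init x0)
  next
    case (Suc k)
    with dynamics[OF that, of k] show ?thesis
      by (simp add: carrier_vecI)
  qed
  have u_carrier: "u i s \<omega> \<in> carrier_vec 2" if "i < N" "- int (d i) \<le> s" "\<omega> \<in> space M" for i s \<omega>
  proof (cases "s < 0")
    case True
    with that show ?thesis by (simp add: u_init u0)
  next
    case False
    with u_routes[OF that(1,3), of "nat s"] show ?thesis
      by (simp add: block2_def)
  qed
  have u_index: "u i (int t) \<omega> $ c = (incidence N *\<^sub>v vec N (\<lambda>r. u_a r t \<omega>)) $ (2 * i + c)"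
    if "i < N" "c < 2" "\<omega> \<in> space M" for i t c \<omega>
    using u_routes[OF that(1,3), of t] that(2) by (simp add: block2_def)
  have xt_index: "xt i t \<omega> $ p = ext i t \<omega> $ p + (if p < 2 then - e else 0)"
    if "i < N" "p < 2 * (d i + 1)" "\<omega> \<in> space M" for i t p \<omega>
    using that by (simp add: xt x_eq ext_def ext_state_translate)

  \<comment> \<open>By induction over time, the state is an affine function of the actuator outputs
    with deterministic coefficients. Any function algebra containing those outputs therefore
    contains the components of both extended states.\<close>
  have closed: "P (\<lambda>\<omega>. ext i t \<omega> $ p) \<and> P (\<lambda>\<omega>. xt i t \<omega> $ p)"
    if P: "function_algebra M P" and Pu: "\<And>r t. r < N \<Longrightarrow> P (u_a r t)"
      and i: "i < N" and p: "p < 2 * (d i + 1)" for P i t p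
  proof -
    interpret function_algebra M P by (rule P)
    have input: "P (\<lambda>\<omega>. u i s \<omega> $ c)" if "- int (d i) \<le> s" "c < 2" for s c
    proof (cases "s < 0")
      case True
      then show ?thesis
        using const[of "u0 i s $ c"] u_init[OF i that(1)] by (subst cong[where g = "\<lambda>_. u0 i s $ c"]) simp_all
    next
      case False
      then obtain k where s: "s = int k"
        by (metis int_nat_eq linorder_not_le)
      have eq: "u i s \<omega> $ c = (\<Sum>r<N. incidence N $$ (2 * i + c, r) * u_a r k \<omega>)" if "\<omega> \<in> space M" for \<omega>
      proof -
        have "2 * i + c < 2 * N"
          using i \<open>c < 2\<close> by linarith
        then show ?thesis
          using u_index[OF i \<open>c < 2\<close> that]
          by (auto simp: s scalar_prod_def atLeast0LessThan intro!: sum.cong)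
      qed
      have "P (\<lambda>\<omega>. \<Sum>r<N. incidence N $$ (2 * i + c, r) * u_a r k \<omega>)"
        by (intro intros Pu) simp
      then show ?thesis
        by (subst cong[OF eq])
    qed
    have state: "\<forall>c<2. P (\<lambda>\<omega>. x i t \<omega> $ c)" for t
    proof (induction t)
      case 0
      show ?case
      proof (intro allI impI)
        fix c
        show "P (\<lambda>\<omega>. x i 0 \<omega> $ c)"
          using const[of "x0 i $ c"] x_init[OF i] by (subst cong[where g = "\<lambda>_. x0 i $ c"]) simp_all
      qed
    next
      case (Suc t)
      show ?case
      proof (intro allI impI)
        fix c :: nat assume c: "c < 2"
        have eq: "x i (Suc t) \<omega> $ c =
            (A_mat h $$ (c, 0) * x i t \<omega> $ 0 + A_mat h $$ (c, 1) * x i t \<omega> $ 1)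
            + (B_O $$ (c, 0) * u i (int t) \<omega> $ 0 + B_O $$ (c, 1) * u i (int t) \<omega> $ 1)
            + (B_I $$ (c, 0) * u i (int t - int (d i)) \<omega> $ 0 + B_I $$ (c, 1) * u i (int t - int (d i)) \<omega> $ 1)"
          if "\<omega> \<in> space M" for \<omega>
          using dynamics[OF i that, of t] c x_carrier[OF i that, of t]
            u_carrier[OF i _ that, of "int t"] u_carrier[OF i _ that, of "int t - int (d i)"]
          by (simp add: mult_mat_vec_2[OF A_mat_carrier] mult_mat_vec_2[OF B_O_carrier]
              mult_mat_vec_2[OF B_I_carrier] del: index_mult_mat_vec(1))
        have "P (\<lambda>\<omega>. (A_mat h $$ (c, 0) * x i t \<omega> $ 0 + A_mat h $$ (c, 1) * x i t \<omega> $ 1)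
            + (B_O $$ (c, 0) * u i (int t) \<omega> $ 0 + B_O $$ (c, 1) * u i (int t) \<omega> $ 1)
            + (B_I $$ (c, 0) * u i (int t - int (d i)) \<omega> $ 0 + B_I $$ (c, 1) * u i (int t - int (d i)) \<omega> $ 1))"
          using Suc.IH by (intro intros input) simp_all
        then show "P (\<lambda>\<omega>. x i (Suc t) \<omega> $ c)"
          by (subst cong[OF eq])
      qed
    qed
    have ext: "P (\<lambda>\<omega>. ext i t \<omega> $ p)"
      using p state[of t] unfolding ext_def ext_state_index[OF p]
      by (cases "p < 2") (auto intro!: input)
    moreover have "P (\<lambda>\<omega>. xt i t \<omega> $ p)"
      using add[OF ext const] by (subst cong[OF xt_index[OF i p]])
    ultimately show ?thesis ..
  qed

  \<comment> \<open>Only measurability is available so far. It makes \<open>F t\<close> a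
    subalgebra, which is what the actuator law is read on; boundedness is deduced from that law
    afterwards.\<close>
  have subalg: "subalgebra M (F t)" for t
    unfolding F_def using closed[OF function_algebra_measurable[OF refl] u_a_rv]
    by (intro subalgebra_state_algebra) blast
  have F_eq: "F t = state_algebra M N d (\<lambda>i. ext i t)" for t
    unfolding F_def by (rule state_algebra_translate, rule xt_index)
  have law: "AE \<omega> in M. real_cond_exp M (F t) (indicator {\<omega> \<in> space M. u_a r t \<omega> = a}) \<omega> = pmf (actuator (u_c r t \<omega>)) a"
    if "r < N" "a \<in> {-1, 0, 1}" for r t a
    using actuation[OF that, of t] by (simp add: F_eq ext_def[abs_def])
  have u_c_range: "u_c r t \<omega> \<in> {-1..1}" if "r < N" "\<omega> \<in> space M" for r t \<omega>
    using ctrl_range[OF that(1)] controller[OF that] by simp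

  have u_a_bounded: "ess_bounded M (u_a r t)" if "r < N" for r t
  proof -
    interpret S: finite_measure_subalgebra M "F t"
      by unfold_locales (rule subalg)
    have "AE \<omega> in M. u_a r t \<omega> \<in> {-1, 0, 1}"
      using u_a_rv[OF that] u_c_range[OF that] law[OF that] by (rule S.actuator_law_support)
    then have "AE \<omega> in M. \<bar>u_a r t \<omega>\<bar> \<le> 1"
      by eventually_elim auto
    with u_a_rv[OF that] show ?thesis
      by (rule ess_boundedI)
  qed

  interpret S: finite_measure_subalgebra M "F t"
    by unfold_locales (rule subalg)
  interpret B: function_algebra M "ess_bounded M"
    by (rule function_algebra_ess_bounded)
  have space_F: "space (F t) = space M"
    by (simp add: F_def)

  \<comment> \<open>Measurability and boundedness of states, storage and controller inputs\<close>
  have ext_F: "(\<lambda>\<omega>. ext i t \<omega> $ p) \<in> borel_measurable (F t)" if "i < N" "p < 2 * (d i + 1)" for i p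
    unfolding F_eq using that by (rule measurable_state_algebra)
  have xt_F: "(\<lambda>\<omega>. xt i t \<omega> $ p) \<in> borel_measurable (F t)" if "i < N" "p < 2 * (d i + 1)" for i p
    unfolding F_def using that by (rule measurable_state_algebra)
  have ext_bounded: "ess_bounded M (\<lambda>\<omega>. ext i t \<omega> $ p)"
    and xt_bounded: "ess_bounded M (\<lambda>\<omega>. xt i t \<omega> $ p)"
    if "i < N" "p < 2 * (d i + 1)" for i t p
    using closed[OF function_algebra_ess_bounded u_a_bounded that] by blast+
  have xt_carrier: "xt i t \<omega> \<in> carrier_vec (2 * (d i + 1))" if "i < N" "\<omega> \<in> space M" for i t \<omega>
    using ext_state_carrier by (simp only: xt[OF that])
  have Omega_mat_carrier: "Omega_mat h n \<in> carrier_mat (2 * (n + 1)) (2 * (n + 1))" for n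
    by (simp add: Omega_mat_def)

  define V where "V t \<omega> = lyapunov h N d (\<lambda>i. xt i t \<omega>)" for t \<omega>
  have V_closed: "P (V t)"
    if P: "function_algebra M P" and "\<And>i p. i < N \<Longrightarrow> p < 2 * (d i + 1) \<Longrightarrow> P (\<lambda>\<omega>. xt i t \<omega> $ p)" for P t
  proof -
    interpret function_algebra M P by (rule P)
    show ?thesis
      unfolding V_def lyapunov_def
      by (intro intros function_algebra_quadratic_form[OF P _ _ Omega_mat_carrier] xt_carrier that) auto
  qed
  have V_F: "V t \<in> borel_measurable (F t)"
    by (rule V_closed[OF function_algebra_measurable[OF space_F] xt_F])
  have V_bounded: "ess_bounded M (V t)" for t
    by (rule V_closed[OF function_algebra_ess_bounded xt_bounded])

  \<comment> \<open>The controller input is determined by the extended state of the same time, hence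
    \<open>F t\<close>-measurable, as needed to take it out of the conditional expectation.\<close>
  have yc_closed: "P (\<lambda>\<omega>. y_c t \<omega> $ r)"
    if P: "function_algebra M P" and ext: "\<And>i p. i < N \<Longrightarrow> p < 2 * (d i + 1) \<Longrightarrow> P (\<lambda>\<omega>. ext i t \<omega> $ p)"
      and r: "r < N" for P r
  proof -
    interpret function_algebra M P by (rule P)
    have y: "P (\<lambda>\<omega>. y i t \<omega> $ c)" if "i < N" "c < 2" for i c
    proof (subst cong[OF compensator[OF that(1), THEN arg_cong]])
      show "P (\<lambda>\<omega>. comp_out h (d i) (x i t \<omega>) (\<lambda>s. u i s \<omega>) (int t) $ c)"
        using that ext
        by (intro function_algebra_comp_out[OF P d] x_carrier u_carrier) (simp_all add: ext_def)
    qed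
    have eq: "y_c t \<omega> $ r = (\<Sum>p<2 * N. - (incidence N $$ (p, r) * y (p div 2) t \<omega> $ (p mod 2)))"
      if "\<omega> \<in> space M" for \<omega>
      using r feedback[OF that, of t]
      by (auto simp: scalar_prod_def atLeast0LessThan stack2_def sum_negf intro!: sum.cong)
    have "P (\<lambda>\<omega>. \<Sum>p<2 * N. - (incidence N $$ (p, r) * y (p div 2) t \<omega> $ (p mod 2)))"
      by (intro intros y) (auto simp: less_mult_imp_div_less mult.commute)
    then show ?thesis
      by (subst cong[OF eq])
  qed
  have yc_F: "(\<lambda>\<omega>. y_c t \<omega> $ r) \<in> borel_measurable (F t)" if "r < N" for r
    by (rule yc_closed[OF function_algebra_measurable[OF space_F] ext_F that])
  have yc_bounded: "ess_bounded M (\<lambda>\<omega>. y_c t \<omega> $ r)" if "r < N" for r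
    by (rule yc_closed[OF function_algebra_ess_bounded ext_bounded that])

  \<comment> \<open>The share of route \<open>r\<close> in the bound on the increment of
    \<open>V\<close>. The value 0 beyond the last route lets \<open>W_bounded\<close> hold for every
    \<open>r\<close>.\<close>
  define W where "W r \<omega> = (if r < N then \<delta> r * (u_a r t \<omega>)\<^sup>2 - u_a r t \<omega> * y_c t \<omega> $ r else 0)" for r \<omega>
  have W_bounded: "ess_bounded M (W r)" for r
    unfolding W_def power2_eq_square
    by (cases "r < N") (auto intro!: B.intros u_a_bounded yc_bounded)
  have dissipation: "V (t + 1) \<omega> \<le> V t \<omega> + (\<Sum>r<N. W r \<omega>)" if \<omega>: "\<omega> \<in> space M" for \<omega>
  proof -
    \<comment> \<open>Components \<open>2 * i\<close> and \<open>2 * i + 1\<close> of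
      \<open>w\<close> form the current input of process \<open>i\<close>.\<close>
    define w where "w = incidence N *\<^sub>v vec N (\<lambda>r. u_a r t \<omega>)"
    have "1 / 2 * (xt i (t + 1) \<omega> \<bullet> (Omega_mat h (d i) *\<^sub>v xt i (t + 1) \<omega>))
        \<le> 1 / 2 * (xt i t \<omega> \<bullet> (Omega_mat h (d i) *\<^sub>v xt i t \<omega>))
          + (w $ (2 * i) * (y i t \<omega> $ 0 - e) + w $ (2 * i + 1) * (y i t \<omega> $ 1 - e))
          + gamma_m h (d i) * ((w $ (2 * i))\<^sup>2 + (w $ (2 * i + 1))\<^sup>2)" if i: "i < N" for i
    proof -
      have "u i (int t - int (d i) + int b) \<omega> \<in> carrier_vec 2" if "b \<le> d i" for b
        using u_carrier[OF i _ \<omega>] by simp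
      from process_dissipation[where u = "\<lambda>s. u i s \<omega>" and e = e, OF d[OF i] less_imp_le[OF h(1)]
          less_imp_le[OF h(2)] x_carrier[OF i \<omega>, of t] this]
      show ?thesis
        using u_index[OF i _ \<omega>, of 0 t] u_index[OF i _ \<omega>, of 1 t]
        unfolding xt[OF i \<omega>] x_eq dynamics[OF i \<omega>] compensator[OF i \<omega>] w_def
        by (simp add: algebra_simps)
    qed
    then have "V (t + 1) \<omega> \<le> (\<Sum>i<N. 1 / 2 * (xt i t \<omega> \<bullet> (Omega_mat h (d i) *\<^sub>v xt i t \<omega>))
          + (w $ (2 * i) * (y i t \<omega> $ 0 - e) + w $ (2 * i + 1) * (y i t \<omega> $ 1 - e))
          + gamma_m h (d i) * ((w $ (2 * i))\<^sup>2 + (w $ (2 * i + 1))\<^sup>2))"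
      unfolding V_def lyapunov_def by (intro sum_mono) simp
    also have "\<dots> = V t \<omega> + (\<Sum>i<N. w $ (2 * i) * (y i t \<omega> $ 0 - e) + w $ (2 * i + 1) * (y i t \<omega> $ 1 - e))
        + (\<Sum>i<N. gamma_m h (d i) * ((w $ (2 * i))\<^sup>2 + (w $ (2 * i + 1))\<^sup>2))"
      unfolding V_def lyapunov_def sum.distrib ..
    also have "(\<Sum>i<N. w $ (2 * i) * (y i t \<omega> $ 0 - e) + w $ (2 * i + 1) * (y i t \<omega> $ 1 - e)) =
        - (\<Sum>r<N. u_a r t \<omega> * y_c t \<omega> $ r)"
      unfolding w_def feedback[OF \<omega>] by (rule incidence_power_balance)
    also have "(\<Sum>i<N. gamma_m h (d i) * ((w $ (2 * i))\<^sup>2 + (w $ (2 * i + 1))\<^sup>2)) =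
        (\<Sum>p<2 * N. gamma_m h (d (p div 2)) * (w $ p)\<^sup>2)"
      unfolding sum_double by (intro sum.cong) (simp_all add: distrib_left)
    \<comment> \<open>The matrix inequality for \<open>\<delta>\<close> turns input energy weighted
      per process into actuator energy weighted per route.\<close>
    also have "\<dots> \<le> (\<Sum>r<N. \<delta> r * (u_a r t \<omega>)\<^sup>2)"
      using psd_mat_diag_congruence[OF delta incidence_carrier, of "vec N (\<lambda>r. u_a r t \<omega>)"]
      by (simp add: w_def del: index_mult_mat_vec(1))
    finally show ?thesis
      by (simp add: W_def sum_subtractf)
  qed

  have W_cond: "AE \<omega> in M. real_cond_exp M (F t) (W r) \<omega> \<le> 0" if r: "r < N" for r
  proof -
    have eq: "AE \<omega> in M. real_cond_exp M (F t) (\<lambda>\<omega>. \<delta> r * (u_a r t \<omega>)\<^sup>2 - u_a r t \<omega> * y_c t \<omega> $ r) \<omega> =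
        \<delta> r * \<bar>u_c r t \<omega>\<bar> - u_c r t \<omega> * y_c t \<omega> $ r"
      using u_a_rv[OF r] u_c_range[OF r] law[OF r] yc_F[OF r] yc_bounded[OF r]
      by (rule S.actuator_law_cond_exp)
    \<comment> \<open>Condition (ii) at the input value \<open>y_c t \<omega> $ r\<close>: the
      actuator has mean \<open>u_c\<close> and second moment \<open>|u_c|\<close>.\<close>
    have le: "\<delta> r * \<bar>u_c r t \<omega>\<bar> \<le> u_c r t \<omega> * y_c t \<omega> $ r" if "\<omega> \<in> space M" for \<omega>
    proof -
      have "\<bar>c\<bar> * (sgn c * v) = c * v" "\<bar>c\<bar> * (sgn c)\<^sup>2 = \<bar>c\<bar>" for c v :: real
        by (auto simp: sgn_if)
      with ctrl_passive[OF r, of "y_c t \<omega> $ r"] show ?thesis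
        unfolding controller[OF r that] expectation_actuator[OF ctrl_range[OF r]] by simp
    qed
    have W: "W r = (\<lambda>\<omega>. \<delta> r * (u_a r t \<omega>)\<^sup>2 - u_a r t \<omega> * y_c t \<omega> $ r)"
      using r by (simp add: W_def[abs_def])
    from eq AE_space show ?thesis
      unfolding W by eventually_elim (use le in auto)
  qed

  \<comment> \<open>The pathwise bound is conditioned on \<open>F t\<close>: \<open>V t\<close> is
    \<open>F t\<close>-measurable and reproduces itself, and each \<open>W r\<close> contributes a
    nonpositive term.\<close>
  have "AE \<omega> in M. real_cond_exp M (F t) (V (t + 1)) \<omega> \<le>
      real_cond_exp M (F t) (\<lambda>\<omega>. V t \<omega> + (\<Sum>r<N. W r \<omega>)) \<omega>"
    using dissipation
    by (intro S.real_cond_exp_mono integrable_ess_bounded B.intros V_bounded W_bounded) auto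
  moreover have "AE \<omega> in M. real_cond_exp M (F t) (\<lambda>\<omega>. V t \<omega> + (\<Sum>r<N. W r \<omega>)) \<omega> =
      real_cond_exp M (F t) (V t) \<omega> + real_cond_exp M (F t) (\<lambda>\<omega>. \<Sum>r<N. W r \<omega>) \<omega>"
    by (intro S.real_cond_exp_add integrable_ess_bounded B.sum V_bounded W_bounded)
  moreover have "AE \<omega> in M. real_cond_exp M (F t) (V t) \<omega> = V t \<omega>"
    by (intro S.real_cond_exp_F_meas integrable_ess_bounded V_bounded V_F)
  moreover have "AE \<omega> in M. real_cond_exp M (F t) (\<lambda>\<omega>. \<Sum>r<N. W r \<omega>) \<omega> =
      (\<Sum>r<N. real_cond_exp M (F t) (W r) \<omega>)"
    by (intro S.real_cond_exp_sum integrable_ess_bounded W_bounded)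
  moreover have "AE \<omega> in M. \<forall>r\<in>{..<N}. real_cond_exp M (F t) (W r) \<omega> \<le> 0"
    using W_cond by (intro AE_finite_allI) auto
  ultimately have "AE \<omega> in M. real_cond_exp M (F t) (V (t + 1)) \<omega> - V t \<omega> \<le> 0"
  proof eventually_elim
    case (elim \<omega>)
    have "(\<Sum>r<N. real_cond_exp M (F t) (W r) \<omega>) \<le> 0"
      using elim(5) by (intro sum_nonpos) simp
    with elim(1-4) show ?case
      by linarith
  qed
  then show "AE \<omega> in M.
      real_cond_exp M (state_algebra M N d (\<lambda>i. xt i t))
        (\<lambda>\<omega>. lyapunov h N d (\<lambda>i. xt i (t + 1) \<omega>)) \<omega>
      - lyapunov h N d (\<lambda>i. xt i t \<omega>) \<le> 0"
    by (simp add: F_def V_def[abs_def])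
qed

end
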